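(* Under the standing assumptions of the context, as $l\to\infty$, $$|\Delta^2_{\widehat{\varphi_l^{\bot}}}-\Delta^2_{\widehat{\varphi^M}}|=O\Big(\max\big\{\mu(l),\,(4e^{2\omega_0})^{-2l+4\log_2\frac{1+\varepsilon(l)}{c}}\big\}\Big).$$
   Context: Fourier transform: $\widehat f(\omega)=\int_{\mathbb{R}}f(t)e^{-it\omega}\,dt$. Let $\theta$ be odd, non-decreasing, $C^2$, with $\theta(\omega)=\pi/4$ for $\omega>\pi/3$; fix $\pi/3\le\omega_0<\pi/2$. Meyer scaling function: $\widehat{\varphi^M}(\omega)=1$ for $|\omega|\le2\omega_0$, $=\cos(\frac\pi4+\theta(\frac{\pi}{3(\pi-2\omega_0)}(|\omega|-\pi)))$ for $2\omega_0<|\omega|\le2\pi-2\omega_0$, $=0$ otherwise. Meyer mask: $2\pi$-periodic $m^M$ with $m^M(\omega)=\widehat{\varphi^M}(2\omega)$ on $[-\pi,\pi]$. $\|\cdot\|_C$: sup norm on $[-\pi,\pi]$. A linear method of summation $(\lambda_{n,k})$ maps $f$ with Fourier coefficients $a_k,b_k$ to $u_n(f,\omega)=\frac{a_0}2+\sum_{k=1}^n\lambda_{n,k}(a_k\cos k\omega+b_k\sin k\omega)$. $m^M_l:=m^M/(\cos\frac\omega2)^{2l}$. Standing assumptions: a method $(\lambda_{n,k})$ and sequence $n(l)$ are fixed with $u_l:=u_{n(l)}(m^M_l,\cdot)$, $u_{1,l}:=u_{n(l)}((m^M_l)',\cdot)$ satisfying $\alpha(l):=\|u_l-m^M_l\|_C=o(l^{-1})$,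 $\gamma(l):=\|u_{1,l}-(m^M_l)'\|_C=o(1)$, $u_l(\pi)\ne0$; $l_0$ is fixed with $c:=\inf_{l\ge l_0}|u_l(0)|>0$ and $l\ge l_0$. $\varepsilon(l):=\alpha(l)/\|m^M_l\|_C$, $\mu(l):=l\alpha(l)+\gamma(l)$. $m_l(\omega):=(\cos\frac\omega2)^{2l}u_l(\omega)/u_l(0)$, $\widehat{\varphi_l}(\omega):=\prod_{j\ge1}m_l(\omega2^{-j})$, $\Phi_l(\omega):=\sum_{k\in\mathbb{Z}}|\widehat{\varphi_l}(\omega+2\pi k)|^2$, $\widehat{\varphi_l^{\bot}}:=\widehat{\varphi_l}\Phi_l^{-1/2}$. Frequency radius: $\Delta^2_{\widehat f}=\|\widehat f\|_{L^2}^{-2}\int(\omega-\omega_{0\widehat f})^2|\widehat f(\omega)|^2d\omega$ with $\omega_{0\widehat f}=\|\widehat f\|_{L^2}^{-2}\int\omega|\widehat f(\omega)|^2d\omega$. *)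

theory Defs
  imports "HOL-Analysis.Analysis" "HOL-Library.Landau_Symbols"
begin

definition admissible_theta :: "(real \<Rightarrow> real) \<Rightarrow> bool" where
  "admissible_theta \<theta> \<longleftrightarrow>
     (\<forall>x. \<theta> (-x) = - \<theta> x) \<and> mono \<theta> \<and>
     (\<exists>\<theta>1 \<theta>2. (\<forall>x. (\<theta> has_real_derivative \<theta>1 x) (at x)) \<and>
               (\<forall>x. (\<theta>1 has_real_derivative \<theta>2 x) (at x)) \<and> continuous_on UNIV \<theta>2) \<and>
     (\<forall>x. x > pi/3 \<longrightarrow> \<theta> x = pi/4)"

definition meyer_hat :: "(real \<Rightarrow> real) \<Rightarrow> real \<Rightarrow> real \<Rightarrow> real" where
  "meyer_hat \<theta> \<omega>0 \<omega> =
     (if \<bar>\<omega>\<bar> \<le> 2*\<omega>0 then 1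
      else if \<bar>\<omega>\<bar> \<le> 2*pi - 2*\<omega>0
        then cos (pi/4 + \<theta> (pi / (3*(pi - 2*\<omega>0)) * (\<bar>\<omega>\<bar> - pi)))
      else 0)"

definition red2pi :: "real \<Rightarrow> real" where
  "red2pi \<omega> = \<omega> - 2*pi * of_int \<lfloor>(\<omega> + pi) / (2*pi)\<rfloor>"

definition meyer_mask :: "(real \<Rightarrow> real) \<Rightarrow> real \<Rightarrow> real \<Rightarrow> real" where
  "meyer_mask \<theta> \<omega>0 \<omega> = meyer_hat \<theta> \<omega>0 (2 * red2pi \<omega>)"

definition meyer_mask_l :: "(real \<Rightarrow> real) \<Rightarrow> real \<Rightarrow> nat \<Rightarrow> real \<Rightarrow> real" where
  "meyer_mask_l \<theta> \<omega>0 l \<omega> = meyer_mask \<theta> \<omega>0 \<omega> / (cos (\<omega>/2)) ^ (2*l)"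

definition supC :: "(real \<Rightarrow> real) \<Rightarrow> real" where
  "supC f = (SUP \<omega>\<in>{-pi..pi}. \<bar>f \<omega>\<bar>)"

definition fourier_a :: "(real \<Rightarrow> real) \<Rightarrow> nat \<Rightarrow> real" where
  "fourier_a f k = (1/pi) * integral {-pi..pi} (\<lambda>t. f t * cos (real k * t))"

definition fourier_b :: "(real \<Rightarrow> real) \<Rightarrow> nat \<Rightarrow> real" where
  "fourier_b f k = (1/pi) * integral {-pi..pi} (\<lambda>t. f t * sin (real k * t))"

definition lin_sum :: "(nat \<Rightarrow> nat \<Rightarrow> real) \<Rightarrow> nat \<Rightarrow> (real \<Rightarrow> real) \<Rightarrow> real \<Rightarrow> real" where
  "lin_sum lam n f \<omega> = fourier_a f 0 / 2 +
     (\<Sum>k=1..n. lam n k * (fourier_a f k * cos (real k * \<omega>) + fourier_b f k * sin (real k * \<omega>)))"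

definition L2sq :: "(real \<Rightarrow> real) \<Rightarrow> real" where
  "L2sq f = (\<integral>\<omega>. (f \<omega>)\<^sup>2 \<partial>lborel)"

definition freq_center :: "(real \<Rightarrow> real) \<Rightarrow> real" where
  "freq_center f = (\<integral>\<omega>. \<omega> * (f \<omega>)\<^sup>2 \<partial>lborel) / L2sq f"

definition freq_radius_sq :: "(real \<Rightarrow> real) \<Rightarrow> real" where
  "freq_radius_sq f = (\<integral>\<omega>. (\<omega> - freq_center f)\<^sup>2 * (f \<omega>)\<^sup>2 \<partial>lborel) / L2sq f"

definition mask_l :: "nat \<Rightarrow> (real \<Rightarrow> real) \<Rightarrow> real \<Rightarrow> real" where
  "mask_l l u \<omega> = (cos (\<omega>/2)) ^ (2*l) * u \<omega> / u 0"

definition scal_hat :: "nat \<Rightarrow> (real \<Rightarrow> real) \<Rightarrow> real \<Rightarrow> real" where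
  "scal_hat l u \<omega> = (\<Prod>j. mask_l l u (\<omega> / 2 ^ Suc j))"

definition Phi_l :: "nat \<Rightarrow> (real \<Rightarrow> real) \<Rightarrow> real \<Rightarrow> real" where
  "Phi_l l u \<omega> = (\<Sum>\<^sub>\<infinity>k\<in>(UNIV::int set). \<bar>scal_hat l u (\<omega> + 2 * pi * (of_int k))\<bar>\<^sup>2)"

definition orth_hat :: "nat \<Rightarrow> (real \<Rightarrow> real) \<Rightarrow> real \<Rightarrow> real" where
  "orth_hat l u \<omega> = scal_hat l u \<omega> / sqrt (Phi_l l u \<omega>)"

end

theory Submission
  imports Defs "HOL-Probability.Sinc_Integral"
begin

text \<open>Write \<open>m\<close> for the mask \<open>m_l\<close>. Since \<open>u_l'\<close> is the summation method applied to the derivative of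
  \<open>m\<^sup>M_l\<close>, the mask is close to the Meyer mask in three ways: it differs from it by \<open>O(\<mu>)\<close> everywhere,
  it is \<open>O(\<mu>) cos(\<omega>/2)^(2l)\<close> where the Meyer mask vanishes, and it is \<open>1 + O(\<mu> |\<omega>|)\<close> near the
  origin. For the infinite product \<open>P\<close> one has \<open>P(2\<omega>) = m(\<omega>) P(\<omega>)\<close>. Let \<open>d\<close> be the distance of
  \<open>\<omega>\<close> to the lattice of multiples of \<open>2\<pi>\<close>. The bound \<open>|P(\<omega>)| \<le> K |\<omega>|^(-4) \<psi>(d)\<close>, with \<open>\<psi>(d) = d^5\<close>
  where the Meyer mask lives and a large constant elsewhere, is stable under doubling. Hence \<open>P\<close> differs
  from the Meyer function by \<open>O(\<mu> (1 + \<omega>\<^sup>2)^(-2))\<close>, so \<open>\<Phi>_l = 1 + O(\<mu>)\<close>, and all moments up to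
  order two, hence the squared radius, change by \<open>O(\<mu>)\<close>.\<close>

subsection \<open>Reduction modulo the period and the Meyer function\<close>

lemma red2pi_decomp: "\<omega> = red2pi \<omega> + 2 * pi * of_int \<lfloor>(\<omega> + pi) / (2*pi)\<rfloor>"
  by (simp add: red2pi_def)

lemma red2pi_bounds: "- pi \<le> red2pi \<omega>" "red2pi \<omega> < pi"
proof -
  have "of_int \<lfloor>(\<omega> + pi) / (2*pi)\<rfloor> \<le> (\<omega> + pi) / (2*pi)"
    "(\<omega> + pi) / (2*pi) < of_int \<lfloor>(\<omega> + pi) / (2*pi)\<rfloor> + 1"
    by linarith+
  then have "of_int \<lfloor>(\<omega> + pi) / (2*pi)\<rfloor> * (2*pi) \<le> \<omega> + pi"
    "\<omega> + pi < (of_int \<lfloor>(\<omega> + pi) / (2*pi)\<rfloor> + 1) * (2*pi)"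
    by (simp_all only: pos_le_divide_eq pos_divide_less_eq pi_gt_zero mult_pos_pos zero_less_numeral)
  then show "- pi \<le> red2pi \<omega>" "red2pi \<omega> < pi"
    unfolding red2pi_def by (simp_all add: algebra_simps)
qed

lemma abs_red2pi_le: "\<bar>red2pi \<omega>\<bar> \<le> pi"
  using red2pi_bounds[of \<omega>] by linarith

lemma red2pi_shift: "red2pi (\<omega> + 2 * pi * of_int k) = red2pi \<omega>"
proof -
  have "(\<omega> + 2 * pi * of_int k + pi) / (2*pi) = (\<omega> + pi) / (2*pi) + of_int k"
    by (simp add: field_simps)
  then show ?thesis
    unfolding red2pi_def by (simp add: algebra_simps)
qed

lemma red2pi_id: "- pi \<le> x \<Longrightarrow> x < pi \<Longrightarrow> red2pi x = x"
proof -
  assume "- pi \<le> x" "x < pi"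
  then have "\<lfloor>(x + pi) / (2*pi)\<rfloor> = 0" by (simp add: floor_eq_iff)
  then show ?thesis by (simp add: red2pi_def)
qed

text \<open>Absolute values are used because \<open>red2pi\<close> takes values in [-pi, pi): it
  sends the endpoint pi to -pi, and only the distance to the lattice is preserved.\<close>

lemma abs_red2pi_eq:
  assumes "\<bar>x\<bar> \<le> pi"
  shows "\<bar>red2pi (x + 2 * pi * of_int k)\<bar> = \<bar>x\<bar>"
proof (cases "x < pi")
  case True
  then show ?thesis using assms red2pi_id[of x] by (simp add: red2pi_shift)
next
  case False
  then have "x = - pi + 2 * pi * of_int 1" using assms by simp
  then have "red2pi x = - pi" using red2pi_shift[of "-pi" 1] red2pi_id[of "-pi"] by simp
  then show ?thesis using False assms by (simp add: red2pi_shift)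
qed

text \<open>Under doubling, the distance to the lattice follows the tent map. The estimates for
  \<open>\<psi>\<close> depend on which of the two branches applies.\<close>

lemma abs_red2pi_double:
  "\<bar>red2pi (2 * \<omega>)\<bar> = (if \<bar>red2pi \<omega>\<bar> \<le> pi / 2 then 2 * \<bar>red2pi \<omega>\<bar> else 2 * pi - 2 * \<bar>red2pi \<omega>\<bar>)"
proof -
  define x where "x = red2pi \<omega>"
  define k where "k = \<lfloor>(\<omega> + pi) / (2*pi)\<rfloor>"
  have w: "\<omega> = x + 2 * pi * of_int k" using red2pi_decomp[of \<omega>] unfolding x_def k_def .
  have x: "\<bar>x\<bar> \<le> pi" unfolding x_def by (rule abs_red2pi_le)
  show ?thesis
  proof (cases "\<bar>x\<bar> \<le> pi / 2")
    case True
    have "2 * \<omega> = 2 * x + 2 * pi * of_int (2 * k)" using w by simp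
    then show ?thesis
      using abs_red2pi_eq[of "2 * x" "2 * k"] True x_def by simp
  next
    case False
    \<comment> \<open>Now 2x exceeds pi in modulus, so the nearest lattice point is 2 pi or -2 pi,
      according to the sign of x.\<close>
    define s where "s = (if x > 0 then 1 else - 1 :: int)"
    have "2 * \<omega> = (2 * x - 2 * pi * of_int s) + 2 * pi * of_int (2 * k + s)"
      using w by (simp add: algebra_simps)
    moreover have "\<bar>2 * x - 2 * pi * of_int s\<bar> = 2 * pi - 2 * \<bar>x\<bar>"
      using x False by (auto simp: s_def)
    ultimately show ?thesis
      using abs_red2pi_eq[of "2 * x - 2 * pi * of_int s" "2 * k + s"] False x x_def by simp
  qed
qed

text \<open>The function cos(w/2) changes sign under a shift by 2 pi, so only its modulus passes to
  the reduced variable. There the half angle lies in [-pi/2, pi/2], where cosine is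
  nonnegative.\<close>

lemma abs_cos_half_red2pi: "\<bar>cos (\<omega> / 2)\<bar> = cos (\<bar>red2pi \<omega>\<bar> / 2)"
proof -
  define x where "x = red2pi \<omega>"
  define k where "k = \<lfloor>(\<omega> + pi) / (2*pi)\<rfloor>"
  have w: "\<omega> / 2 = x / 2 + pi * of_int k"
    using red2pi_decomp[of \<omega>] unfolding x_def k_def by simp
  have "sin (pi * of_int k) = 0"
    using sin_int_times_real[of k "1"] by (simp add: mult.commute sin_times_pi_eq_0)
  moreover have "\<bar>cos (pi * of_int k)\<bar> = 1"
    using calculation sin_cos_squared_add[of "pi * of_int k"]
    by (metis abs_one add_0 power2_eq_1_iff power_zero_numeral abs_minus_cancel)
  ultimately have "\<bar>cos (\<omega> / 2)\<bar> = \<bar>cos (x / 2)\<bar>"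
    unfolding w cos_add by (simp add: abs_mult)
  also have "\<dots> = \<bar>cos (\<bar>x\<bar> / 2)\<bar>" by (metis abs_divide abs_numeral cos_abs_real)
  also have "\<dots> = cos (\<bar>x\<bar> / 2)"
    using abs_red2pi_le[of \<omega>] by (intro abs_of_nonneg cos_ge_zero) (auto simp: x_def)
  finally show ?thesis unfolding x_def .
qed

section \<open>The Meyer function, its transition profile and its mask\<close>

locale meyer =
  fixes \<theta> :: "real \<Rightarrow> real" and \<omega>0 :: real
  assumes theta: "admissible_theta \<theta>" and om0: "pi/3 \<le> \<omega>0" "\<omega>0 < pi/2"
begin

abbreviation \<phi> :: "real \<Rightarrow> real" where "\<phi> \<equiv> meyer_hat \<theta> \<omega>0"
abbreviation mM :: "real \<Rightarrow> real" where "mM \<equiv> meyer_mask \<theta> \<omega>0"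

definition \<kappa> :: real where "\<kappa> = pi / (3 * (pi - 2 * \<omega>0))"
text \<open>The middle branch of \<open>meyer_hat\<close>, taken for every real t. Since
  \<open>\<theta>\<close> is constant outside [-pi/3, pi/3], this one formula also yields the
  plateau 1 and the value 0 beyond the support; \<open>\<kappa>\<close> maps the transition band
  onto that interval.\<close>

definition H :: "real \<Rightarrow> real" where "H t = cos (pi/4 + \<theta> (\<kappa> * (t - pi)))"

lemma om0_pos: "0 < \<omega>0" using om0 pi_gt_zero by linarith

lemma kappa_pos: "\<kappa> > 0" using om0 by (simp add: \<kappa>_def)

lemma kappa_eq: "\<kappa> * (2 * \<omega>0 - pi) = - pi / 3" "\<kappa> * (pi - 2 * \<omega>0) = pi / 3"
  using om0 by (simp_all add: \<kappa>_def field_simps)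

lemma theta_odd: "\<theta> (- x) = - \<theta> x"
  using theta by (simp add: admissible_theta_def)

lemma theta_mono: "x \<le> y \<Longrightarrow> \<theta> x \<le> \<theta> y"
  using theta by (auto simp: admissible_theta_def mono_def)

lemma theta_C1: "\<exists>\<theta>1. (\<forall>x. (\<theta> has_real_derivative \<theta>1 x) (at x)) \<and> continuous_on UNIV \<theta>1"
  using theta unfolding admissible_theta_def
  by (meson DERIV_continuous_on has_field_derivative_at_within)

lemma theta_isCont: "isCont \<theta> x"
  using theta_C1 DERIV_isCont by blast

text \<open>Admissibility fixes the values only strictly beyond pi/3; continuity adds the endpoint,
  which corresponds to the edge of the transition band.\<close>

lemma theta_ge:
  assumes "x \<ge> pi/3" shows "\<theta> x = pi/4"
proof (cases "x > pi/3")
  case False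
  then have x: "x = pi/3" using assms by simp
  have "(\<theta> \<longlongrightarrow> \<theta> x) (at_right x)"
    using theta_isCont[of x] unfolding isCont_def by (rule tendsto_within_subset) simp
  moreover have "(\<theta> \<longlongrightarrow> pi/4) (at_right x)"
    using theta by (intro tendsto_eventually)
      (auto simp: eventually_at_filter admissible_theta_def x)
  ultimately show ?thesis
    using tendsto_unique trivial_limit_at_right_real by blast
qed (use theta in \<open>auto simp: admissible_theta_def\<close>)

lemma theta_le: "x \<le> - pi/3 \<Longrightarrow> \<theta> x = - pi/4"
  using theta_ge[of "-x"] theta_odd[of x] by simp

lemma theta_range: "\<bar>\<theta> x\<bar> \<le> pi/4"
proof -
  have "\<theta> x \<le> pi/4" for x
    using theta_mono[of x "max x (pi/3)"] theta_ge[of "max x (pi/3)"] by simp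
  from this[of x] this[of "-x"] show ?thesis by (simp add: theta_odd abs_le_iff)
qed

lemma H_low: "t \<le> 2 * \<omega>0 \<Longrightarrow> H t = 1"
proof -
  assume "t \<le> 2 * \<omega>0"
  then have "\<kappa> * (t - pi) \<le> \<kappa> * (2 * \<omega>0 - pi)" using kappa_pos by simp
  then have "\<kappa> * (t - pi) \<le> - pi / 3" by (simp add: kappa_eq)
  then show ?thesis by (simp add: H_def theta_le)
qed

lemma H_high: "t \<ge> 2 * pi - 2 * \<omega>0 \<Longrightarrow> H t = 0"
proof -
  assume "t \<ge> 2 * pi - 2 * \<omega>0"
  then have "\<kappa> * (t - pi) \<ge> \<kappa> * (pi - 2 * \<omega>0)" using kappa_pos by simp
  then have "\<kappa> * (t - pi) \<ge> pi / 3" by (simp add: kappa_eq)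
  then have "pi/4 + \<theta> (\<kappa> * (t - pi)) = pi/2" by (simp add: theta_ge)
  then show ?thesis unfolding H_def by (metis cos_pi_half)
qed

lemma H_range: "0 \<le> H t" "H t \<le> 1"
  using theta_range[of "\<kappa> * (t - pi)"] by (auto simp: H_def abs_le_iff intro!: cos_ge_zero)

lemma phi_abs: "\<phi> \<omega> = H \<bar>\<omega>\<bar>"
  using H_low[of "\<bar>\<omega>\<bar>"] H_high[of "\<bar>\<omega>\<bar>"] by (auto simp: meyer_hat_def H_def \<kappa>_def)

text \<open>This removes the absolute value, so that smoothness at the origin is automatic.\<close>

lemma phi_prod: "\<phi> \<omega> = H \<omega> * H (- \<omega>)"
  using H_low[of "-\<bar>\<omega>\<bar>"] om0_pos by (auto simp: phi_abs abs_if split: if_splits)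

lemma phi_range: "0 \<le> \<phi> \<omega>" "\<phi> \<omega> \<le> 1"
  using H_range by (auto simp: phi_abs)

lemma phi_one: "\<bar>\<omega>\<bar> \<le> 2 * \<omega>0 \<Longrightarrow> \<phi> \<omega> = 1"
  by (simp add: phi_abs H_low)

lemma phi_zero: "\<bar>\<omega>\<bar> \<ge> 2 * (pi - \<omega>0) \<Longrightarrow> \<phi> \<omega> = 0"
  by (simp add: phi_abs H_high)

lemma mM_range: "0 \<le> mM \<omega>" "mM \<omega> \<le> 1"
  by (simp_all add: meyer_mask_def phi_range)

lemma mM_red: "mM (red2pi \<omega>) = mM \<omega>"
  using red2pi_id[OF red2pi_bounds] by (simp add: meyer_mask_def)

lemma mM_eq: "\<bar>\<omega>\<bar> \<le> pi \<Longrightarrow> mM \<omega> = \<phi> (2 * \<omega>)"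
  using abs_red2pi_eq[of \<omega> 0] by (simp add: meyer_mask_def phi_abs abs_mult)

text \<open>Slightly beyond pi in modulus both sides vanish, so the identity holds on a
  neighbourhood of [-pi, pi]. This is what yields two-sided derivatives at the endpoints.\<close>

lemma mM_eq_wide:
  assumes "\<bar>\<omega>\<bar> \<le> pi + \<omega>0" shows "mM \<omega> = \<phi> (2 * \<omega>)"
proof (cases "\<bar>\<omega>\<bar> \<le> pi")
  case False
  define s where "s = (if \<omega> > 0 then 1 else - 1 :: int)"
  have *: "\<bar>\<omega> - 2 * pi * s\<bar> = 2 * pi - \<bar>\<omega>\<bar>" using assms False om0 by (auto simp: s_def)
  have "\<bar>red2pi \<omega>\<bar> = 2 * pi - \<bar>\<omega>\<bar>"
    using abs_red2pi_eq[of "\<omega> - 2 * pi * s" s] * False assms by (simp add: s_def)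
  then show ?thesis
    using assms False om0 by (simp add: meyer_mask_def phi_zero abs_mult)
qed (simp add: mM_eq)

lemma mM_zero: "\<bar>red2pi \<omega>\<bar> \<ge> pi - \<omega>0 \<Longrightarrow> mM \<omega> = 0"
  by (simp add: meyer_mask_def phi_zero abs_mult)

lemma phi_C1: "\<exists>D. (\<forall>x. (\<phi> has_real_derivative D x) (at x)) \<and> continuous_on UNIV D"
proof -
  obtain \<theta>1 where t: "\<And>x. (\<theta> has_real_derivative \<theta>1 x) (at x)" and ct: "continuous_on UNIV \<theta>1"
    using theta_C1 by blast
  have c\<theta>: "continuous_on UNIV \<theta>" using theta_isCont continuous_at_imp_continuous_on by blast
  define H1 where "H1 x = - sin (pi/4 + \<theta> (\<kappa> * (x - pi))) * (\<theta>1 (\<kappa> * (x - pi)) * \<kappa>)" for x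
  have H': "(H has_real_derivative H1 x) (at x)" for x
    unfolding H_def[abs_def] H1_def
    by (rule derivative_eq_intros DERIV_chain'[where f="\<lambda>x. \<kappa> * (x - pi)" and g=\<theta>] t | simp)+
  have cH1: "continuous_on UNIV H1"
    unfolding H1_def by (intro continuous_intros continuous_on_compose2[OF ct] continuous_on_compose2[OF c\<theta>]) auto
  have cH: "continuous_on UNIV H" using H' DERIV_isCont continuous_at_imp_continuous_on by blast
  have "((\<lambda>x. H x * H (- x)) has_real_derivative (H1 x * H (- x) + (H1 (- x) * - 1) * H x)) (at x)" for x
    by (rule DERIV_mult' [THEN DERIV_cong] DERIV_chain'[where g=H and f=uminus] H' derivative_eq_intros | simp)+
  moreover have "continuous_on UNIV (\<lambda>x. H1 x * H (- x) + (H1 (- x) * - 1) * H x)"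
    by (intro continuous_intros continuous_on_compose2[OF cH] continuous_on_compose2[OF cH1]) auto
  moreover have "\<phi> = (\<lambda>x. H x * H (- x))" using phi_prod by blast
  ultimately show ?thesis
    by (intro exI[of _ "\<lambda>x. H1 x * H (- x) + (H1 (- x) * - 1) * H x"] conjI allI) simp_all
qed

text \<open>The identity behind the orthonormality of the Meyer scaling function. At most two
  translates are nonzero, and oddness of \<open>\<theta>\<close> makes their values the cosine and
  sine of one angle.\<close>

lemma phi_periodization_sq:
  "(\<Sum>\<^sub>\<infinity>k\<in>(UNIV::int set). (\<phi> (x + 2 * pi * of_int k))\<^sup>2) = 1"
  "(\<lambda>k. (\<phi> (x + 2 * pi * of_int k))\<^sup>2) summable_on (UNIV::int set)"
  if x: "\<bar>x\<bar> \<le> pi"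
proof -
  have big: "\<phi> (x + 2 * pi * of_int k) = 0" if "k \<notin> {-1,0,1::int}" for k
  proof -
    have "\<bar>k\<bar> \<ge> 2" using that by auto
    then have "\<bar>of_int k :: real\<bar> \<ge> 2" by linarith
    then have "2 * pi * 2 \<le> 2 * pi * \<bar>of_int k\<bar>" by (intro mult_left_mono) auto
    then have "\<bar>2 * pi * of_int k\<bar> \<ge> 4 * pi" by (simp add: abs_mult)
    moreover have "\<bar>2 * pi * of_int k\<bar> \<le> \<bar>x + 2 * pi * of_int k\<bar> + \<bar>x\<bar>" by simp
    ultimately show ?thesis using x om0_pos pi_gt_zero by (intro phi_zero) argo
  qed
  have "((\<lambda>k. (\<phi> (x + 2 * pi * of_int k))\<^sup>2) has_sum (\<Sum>k\<in>{-1,0,1::int}. (\<phi> (x + 2 * pi * of_int k))\<^sup>2)) UNIV"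
    by (rule has_sum_finite_neutralI[where B="{-1,0,1}"]) (use big in auto)
  moreover have "(\<Sum>k\<in>{-1,0,1::int}. (\<phi> (x + 2 * pi * of_int k))\<^sup>2) = 1"
  proof -
    have e: "(\<Sum>k\<in>{-1,0,1::int}. (\<phi> (x + 2 * pi * of_int k))\<^sup>2) = (H \<bar>x\<bar>)\<^sup>2 + (H (2 * pi - \<bar>x\<bar>))\<^sup>2"
    proof (cases "x \<ge> 0")
      case True
      then have "\<bar>x - 2 * pi\<bar> = 2 * pi - \<bar>x\<bar>" "\<phi> (x + 2 * pi) = 0"
        using x om0_pos by (auto intro!: phi_zero)
      then show ?thesis by (simp add: phi_abs)
    next
      case False
      then have "\<bar>x + 2 * pi\<bar> = 2 * pi - \<bar>x\<bar>" "\<phi> (x - 2 * pi) = 0"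
        using x om0_pos by (auto intro!: phi_zero)
      then show ?thesis by (simp add: phi_abs)
    qed
    define s where "s = \<theta> (\<kappa> * (\<bar>x\<bar> - pi))"
    \<comment> \<open>Reflecting t to 2 pi - t negates the argument of \<open>\<theta>\<close>, so
      pi/4 + s becomes pi/4 - s.\<close>
    have "\<kappa> * (2 * pi - \<bar>x\<bar> - pi) = - (\<kappa> * (\<bar>x\<bar> - pi))" by (simp add: algebra_simps)
    then have "H (2 * pi - \<bar>x\<bar>) = cos (pi/4 - s)" unfolding H_def s_def by (simp only: theta_odd) simp
    also have "\<dots> = sin (pi/4 + s)" by (simp add: sin_cos_eq)
    finally show ?thesis unfolding e by (simp add: H_def s_def)
  qed
  ultimately have "((\<lambda>k. (\<phi> (x + 2 * pi * of_int k))\<^sup>2) has_sum 1) (UNIV :: int set)" by simp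
  then show "(\<Sum>\<^sub>\<infinity>k\<in>(UNIV::int set). (\<phi> (x + 2 * pi * of_int k))\<^sup>2) = 1"
     "(\<lambda>k. (\<phi> (x + 2 * pi * of_int k))\<^sup>2) summable_on (UNIV::int set)"
    by (auto simp: infsumI summable_on_def)
qed

end

subsection \<open>Infinite products of perturbed Meyer masks\<close>

lemma exp_minus_1_le: "0 \<le> x \<Longrightarrow> x \<le> 1 \<Longrightarrow> exp x - 1 \<le> 2 * (x::real)"
  using exp_bound[of x] mult_left_le[of x x] by (simp add: power2_eq_square)

lemma weight_pos: "0 < (1 + x\<^sup>2 :: real)\<^sup>2"
  by (intro zero_less_power add_pos_nonneg) auto

text \<open>Isolates the pointwise facts about the mask, so that the product estimates do not see
  the summation method. The linear bound \<open>m_low\<close> makes errors summable along x / 2^j; l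
  >= 3 gives 2l >= 5, the exponent in \<open>\<psi>\<close>; 2^32 is the constant of
  \<open>P_near_phi\<close>.\<close>

locale near_meyer = meyer +
  fixes m :: "real \<Rightarrow> real" and \<eta> :: real and l :: nat
  assumes eta: "0 \<le> \<eta>" "2^32 * \<eta> \<le> 1" and l: "l \<ge> 3"
    and m_near: "\<And>x. \<bar>m x - mM x\<bar> \<le> \<eta>"
    and m_bad: "\<And>x. pi - \<omega>0 \<le> \<bar>red2pi x\<bar> \<Longrightarrow> \<bar>m x\<bar> \<le> \<eta> * \<bar>cos (x/2)\<bar> ^ (2 * l)"
    and m_low: "\<And>x. \<bar>x\<bar> \<le> \<omega>0 \<Longrightarrow> \<bar>m x - 1\<bar> \<le> \<eta> * \<bar>x\<bar>"
    and m_meas: "m \<in> borel_measurable borel"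
begin

definition P :: "real \<Rightarrow> real" where "P \<omega> = (\<Prod>j. m (\<omega> / 2 ^ Suc j))"

text \<open>A doubling step must absorb the factor 16 from the fourth power and a mask of size up to
  2. The exponent 5 gives exactly 2^5 = 32, and 2^15 = 32 * 4^5 dominates 32 d^5 for every d <= pi <
  4.\<close>

definition \<psi> :: "real \<Rightarrow> real" where
  "\<psi> \<omega> = (if \<bar>red2pi \<omega>\<bar> < pi - \<omega>0 then \<bar>red2pi \<omega>\<bar> ^ 5 else 2 ^ 15)"

lemma eta_le: "\<eta> \<le> 1 / 1000000"
  using eta by simp

lemma m_le_2: "\<bar>m x\<bar> \<le> 2"
  using m_near[of x] mM_range[of x] eta_le by linarith

text \<open>After N halvings the arguments lie in [-\<open>\<omega>0\<close>,
  \<open>\<omega>0\<close>], where \<open>m_low\<close> makes the deviations from 1 geometric. The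
  first N factors may vanish without harming \<open>convergent_prod\<close>.\<close>

lemma P_convergent: "convergent_prod (\<lambda>j. m (\<omega> / 2 ^ Suc j))"
proof -
  obtain N :: nat where N: "\<bar>\<omega>\<bar> / \<omega>0 < 2 ^ N"
    using real_arch_pow[of 2 "\<bar>\<omega>\<bar> / \<omega>0"] by auto
  have bd: "\<bar>\<omega> / 2 ^ Suc (j + N)\<bar> \<le> \<omega>0" for j
  proof -
    have "\<bar>\<omega>\<bar> \<le> \<omega>0 * 2 ^ N" using N om0_pos by (simp add: field_simps)
    also have "\<dots> \<le> \<omega>0 * 2 ^ Suc (j + N)" using om0_pos by (intro mult_left_mono power_increasing) auto
    finally show ?thesis by (simp add: field_simps)
  qed
  have "summable (\<lambda>j. norm (m (\<omega> / 2 ^ Suc (j + N)) - 1))"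
  proof (rule summable_comparison_test')
    show "summable (\<lambda>j. \<eta> * \<bar>\<omega>\<bar> * (1/2) ^ j)" by (intro summable_mult summable_geometric) simp
    show "norm (norm (m (\<omega> / 2 ^ Suc (j + N)) - 1)) \<le> \<eta> * \<bar>\<omega>\<bar> * (1/2) ^ j" if "j \<ge> 0" for j
    proof -
      have "\<bar>\<omega>\<bar> / 2 ^ Suc (j + N) \<le> \<bar>\<omega>\<bar> / 2 ^ j"
        by (intro divide_left_mono power_increasing) auto
      then have "\<eta> * \<bar>\<omega> / 2 ^ Suc (j + N)\<bar> \<le> \<eta> * (\<bar>\<omega>\<bar> / 2 ^ j)"
        using eta by (intro mult_left_mono) auto
      then have "\<bar>m (\<omega> / 2 ^ Suc (j + N)) - 1\<bar> \<le> \<eta> * (\<bar>\<omega>\<bar> / 2 ^ j)"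
        using m_low[OF bd[of j]] by linarith
      then show ?thesis by (simp add: power_one_over)
    qed
  qed
  then have "convergent_prod (\<lambda>j. m (\<omega> / 2 ^ Suc (j + N)))"
    by (intro abs_convergent_prod_imp_convergent_prod summable_imp_abs_convergent_prod)
  then show ?thesis by (rule convergent_prod_offset)
qed

lemma P_limit: "(\<lambda>n. \<Prod>j\<le>n. m (\<omega> / 2 ^ Suc j)) \<longlonglongrightarrow> P \<omega>"
  unfolding P_def by (rule convergent_prod_LIMSEQ[OF P_convergent])

text \<open>The refinement equation: the factor of index 0 splits off from each partial
  product.\<close>

lemma P_double: "P (2 * \<omega>) = m \<omega> * P \<omega>"
proof -
  have "(\<lambda>n. \<Prod>j\<le>Suc n. m (2 * \<omega> / 2 ^ Suc j)) \<longlonglongrightarrow> P (2 * \<omega>)"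
    using P_limit[of "2 * \<omega>"] by (rule LIMSEQ_Suc)
  moreover have "(\<Prod>j\<le>Suc n. m (2 * \<omega> / 2 ^ Suc j)) = m \<omega> * (\<Prod>j\<le>n. m (\<omega> / 2 ^ Suc j))" for n
    by (subst prod.atMost_Suc_shift) simp
  ultimately have "(\<lambda>n. m \<omega> * (\<Prod>j\<le>n. m (\<omega> / 2 ^ Suc j))) \<longlonglongrightarrow> P (2 * \<omega>)" by simp
  moreover have "(\<lambda>n. m \<omega> * (\<Prod>j\<le>n. m (\<omega> / 2 ^ Suc j))) \<longlonglongrightarrow> m \<omega> * P \<omega>"
    by (intro tendsto_mult tendsto_const P_limit)
  ultimately show ?thesis by (rule LIMSEQ_unique)
qed

lemma P_meas: "P \<in> borel_measurable borel"
proof (rule borel_measurable_LIMSEQ_real)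
  show "(\<lambda>\<omega>. \<Prod>j\<le>n. m (\<omega> / 2 ^ Suc j)) \<in> borel_measurable borel" for n
    by (intro borel_measurable_prod measurable_compose[OF _ m_meas]) measurable
qed (rule P_limit)

text \<open>All arguments of the factors already lie in the range of \<open>m_low\<close>. The
  deviations add up to at most \<open>\<eta> * \<bar>\<omega>\<bar>\<close>, and the product is
  compared with the exponential of this sum.\<close>

lemma P_near_1:
  assumes "\<bar>\<omega>\<bar> \<le> 2 * \<omega>0" shows "\<bar>P \<omega> - 1\<bar> \<le> 2 * (\<eta> * \<bar>\<omega>\<bar>)"
proof -
  \<comment> \<open>Since 2 \<open>\<omega>0\<close> < pi < 4, this quantity lies in [0, 1], where
    exp x - 1 <= 2x.\<close>
  have small: "\<eta> * \<bar>\<omega>\<bar> \<le> 1"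
  proof -
    have "\<bar>\<omega>\<bar> \<le> 4" using assms om0 pi_less_4 by linarith
    then have "\<eta> * \<bar>\<omega>\<bar> \<le> \<eta> * 4" using eta by (intro mult_left_mono)
    then show ?thesis using eta by simp
  qed
  have fin: "\<bar>(\<Prod>j\<le>n. m (\<omega> / 2 ^ Suc j)) - 1\<bar> \<le> 2 * (\<eta> * \<bar>\<omega>\<bar>)" for n
  proof -
    define f where "f j = m (\<omega> / 2 ^ Suc j) - 1" for j
    have f: "\<bar>f j\<bar> \<le> \<eta> * \<bar>\<omega>\<bar> * (1/2) ^ Suc j" for j
    proof -
      have "2 * \<omega>0 * 1 \<le> 2 * \<omega>0 * 2 ^ j" using om0_pos by (intro mult_left_mono) auto
      then have "\<bar>\<omega> / 2 ^ Suc j\<bar> \<le> \<omega>0" using assms by (simp add: field_simps)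
      from m_low[OF this] show ?thesis by (simp add: f_def power_one_over field_simps)
    qed
    have "(\<Sum>j\<le>n. \<bar>f j\<bar>) \<le> (\<Sum>j\<le>n. \<eta> * \<bar>\<omega>\<bar> * (1/2) ^ Suc j)" by (intro sum_mono f)
    also have "\<dots> = \<eta> * \<bar>\<omega>\<bar> * (\<Sum>j\<le>n. (1/2) ^ Suc j)" by (simp add: sum_distrib_left)
    also have "(\<Sum>j\<le>n. (1/2::real) ^ Suc j) \<le> 1"
    proof -
      have "(\<Sum>j\<le>n. (1/2::real) ^ Suc j) = 1 - (1/2) ^ Suc n" by (induction n) auto
      then show ?thesis by simp
    qed
    then have "\<eta> * \<bar>\<omega>\<bar> * (\<Sum>j\<le>n. (1/2::real) ^ Suc j) \<le> \<eta> * \<bar>\<omega>\<bar> * 1"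
      using eta by (intro mult_left_mono) auto
    finally have S: "(\<Sum>j\<le>n. \<bar>f j\<bar>) \<le> \<eta> * \<bar>\<omega>\<bar>" by simp
    have "\<bar>(\<Prod>j\<le>n. 1 + f j) - 1\<bar> \<le> (\<Prod>j\<le>n. 1 + \<bar>f j\<bar>) - 1"
      using norm_prod_minus1_le_prod_minus1[of f "{..n}"] by simp
    also have "\<dots> \<le> exp (\<Sum>j\<le>n. \<bar>f j\<bar>) - 1" using prod_le_exp_sum[of "{..n}" "\<lambda>j. \<bar>f j\<bar>"] by simp
    also have "\<dots> \<le> exp (\<eta> * \<bar>\<omega>\<bar>) - 1" using S by simp
    also have "\<dots> \<le> 2 * (\<eta> * \<bar>\<omega>\<bar>)" using small eta by (intro exp_minus_1_le) auto
    finally show ?thesis by (simp add: f_def)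
  qed
  have "(\<lambda>n. \<bar>(\<Prod>j\<le>n. m (\<omega> / 2 ^ Suc j)) - 1\<bar>) \<longlonglongrightarrow> \<bar>P \<omega> - 1\<bar>"
    by (intro tendsto_intros P_limit)
  then show ?thesis by (rule LIMSEQ_le_const2) (use fin in blast)
qed

text \<open>One refinement step suffices: because \<open>\<omega>0\<close> >= pi/3, half the
  argument lies in the plateau |w| <= 2 \<open>\<omega>0\<close>, where P is near 1. The constant is
  11 = 2 * 5 + 1.\<close>

lemma P_near_phi_center:
  assumes "\<bar>\<omega>\<bar> \<le> 2 * (pi - \<omega>0)" shows "\<bar>P \<omega> - \<phi> \<omega>\<bar> \<le> 11 * \<eta>"
proof -
  have "\<bar>\<omega> / 2\<bar> \<le> 2 * \<omega>0" "\<bar>\<omega> / 2\<bar> \<le> pi" "\<bar>\<omega>\<bar> \<le> 5" using assms om0 pi_less_4 pi_approx by auto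
  have "\<bar>P (\<omega>/2) - 1\<bar> \<le> 2 * (\<eta> * \<bar>\<omega>/2\<bar>)" by (rule P_near_1) fact
  also have "\<dots> = \<eta> * \<bar>\<omega>\<bar>" by simp
  also have "\<dots> \<le> \<eta> * 5" using eta \<open>\<bar>\<omega>\<bar> \<le> 5\<close> by (intro mult_left_mono)
  finally have 1: "\<bar>P (\<omega>/2) - 1\<bar> \<le> 5 * \<eta>" by simp
  have 2: "\<bar>m (\<omega>/2) - \<phi> \<omega>\<bar> \<le> \<eta>" using m_near[of "\<omega>/2"] mM_eq[of "\<omega>/2"] \<open>\<bar>\<omega> / 2\<bar> \<le> pi\<close> by simp
  have "P \<omega> - \<phi> \<omega> = m (\<omega>/2) * (P (\<omega>/2) - 1) + (m (\<omega>/2) - \<phi> \<omega>)"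
    using P_double[of "\<omega>/2"] by (simp add: algebra_simps)
  also have "\<bar>\<dots>\<bar> \<le> \<bar>m (\<omega>/2)\<bar> * \<bar>P (\<omega>/2) - 1\<bar> + \<bar>m (\<omega>/2) - \<phi> \<omega>\<bar>"
    using abs_triangle_ineq by (metis abs_mult)
  also have "\<dots> \<le> 2 * (5 * \<eta>) + \<eta>"
    using m_le_2 1 2 by (intro add_mono mult_mono) auto
  finally show ?thesis by simp
qed

section \<open>Decay of the product outside the support of the Meyer function\<close>

lemma psi_nonneg: "\<psi> \<omega> \<ge> 0"
  by (simp add: \<psi>_def)

lemma psi_le: "\<psi> \<omega> \<le> 2 ^ 15"
proof (cases "\<bar>red2pi \<omega>\<bar> < pi - \<omega>0")
  case True
  have "\<bar>red2pi \<omega>\<bar> ^ 5 \<le> 4 ^ 5" using abs_red2pi_le[of \<omega>] pi_less_4 by (intro power_mono) linarith+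
  then show ?thesis by (simp add: \<psi>_def)
qed (simp add: \<psi>_def)

lemma psi_good:
  assumes "\<bar>red2pi \<omega>\<bar> < pi - \<omega>0"
  shows "32 * \<psi> \<omega> \<le> \<psi> (2 * \<omega>)"
proof (cases "\<bar>red2pi (2 * \<omega>)\<bar> < pi - \<omega>0")
  case True
  \<comment> \<open>The folding branch is impossible: it would put 2w at distance more than 2
    \<open>\<omega>0\<close> >= pi - \<open>\<omega>0\<close> from the lattice.\<close>
  then have "\<bar>red2pi (2 * \<omega>)\<bar> = 2 * \<bar>red2pi \<omega>\<bar>"
    using assms om0 unfolding abs_red2pi_double by (auto split: if_splits)
  then show ?thesis using True assms by (simp add: \<psi>_def power_mult_distrib)
next
  case False
  have "\<bar>red2pi \<omega>\<bar> ^ 5 \<le> 4 ^ 5" using abs_red2pi_le[of \<omega>] pi_less_4 by (intro power_mono) linarith+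
  then show ?thesis using False assms by (simp add: \<psi>_def)
qed

text \<open>Points near odd multiples of pi double to points near the lattice. With d the new
  distance, |cos(w/2)| = sin(d/4) <= d, and 2l >= 5 turns the high-order zero of the cosine power
  into a bound by d^5.\<close>

lemma cos_power_le_psi:
  assumes "pi - \<omega>0 \<le> \<bar>red2pi \<omega>\<bar>"
  shows "\<bar>cos (\<omega>/2)\<bar> ^ (2 * l) \<le> \<psi> (2 * \<omega>)"
proof (cases "\<bar>red2pi (2 * \<omega>)\<bar> < pi - \<omega>0")
  case True
  define d where "d = \<bar>red2pi (2 * \<omega>)\<bar>"
  have d: "d = 2 * pi - 2 * \<bar>red2pi \<omega>\<bar>" using assms om0 unfolding abs_red2pi_double d_def by auto
  have "\<bar>cos (\<omega>/2)\<bar> = cos (pi/2 - d/4)" by (simp add: abs_cos_half_red2pi d field_simps)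
  also have "\<dots> = sin (d/4)" by (simp add: sin_cos_eq)
  also have "\<dots> \<le> d/4" by (rule sin_x_le_x) (simp add: d_def)
  also have "\<dots> \<le> d" by (simp add: d_def)
  finally have "\<bar>cos (\<omega>/2)\<bar> \<le> d" .
  then have "\<bar>cos (\<omega>/2)\<bar> ^ 5 \<le> d ^ 5" by (intro power_mono) auto
  moreover have "\<bar>cos (\<omega>/2)\<bar> ^ (2 * l) \<le> \<bar>cos (\<omega>/2)\<bar> ^ 5"
    using l by (intro power_decreasing) auto
  ultimately have "\<bar>cos (\<omega>/2)\<bar> ^ (2 * l) \<le> d ^ 5" by linarith
  then show ?thesis using True by (simp add: \<psi>_def d_def)
next
  case False
  have "\<bar>cos (\<omega>/2)\<bar> ^ (2 * l) \<le> 1" by (intro power_le_one) auto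
  then show ?thesis using False by (simp add: \<psi>_def)
qed

text \<open>The weight \<open>\<psi>\<close> is built so that this doubling step closes: where the mask is of order 1 the
  distance to \<open>2\<pi>\<int>\<close> doubles, and where the mask is small its factor \<open>cos\<close> pays for landing close
  to \<open>2\<pi>\<int>\<close>.\<close>

lemma P_step:
  assumes K: "K \<ge> 0" and P: "\<bar>P \<omega>\<bar> \<le> K / \<omega> ^ 4 * \<psi> \<omega>"
  shows "\<bar>P (2 * \<omega>)\<bar> \<le> K / (2 * \<omega>) ^ 4 * \<psi> (2 * \<omega>)"
proof -
  have K': "K / (2 * \<omega>) ^ 4 \<ge> 0" using K by simp
  have "\<bar>P (2 * \<omega>)\<bar> = \<bar>m \<omega>\<bar> * \<bar>P \<omega>\<bar>" by (simp add: P_double abs_mult)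
  also have "\<dots> \<le> \<bar>m \<omega>\<bar> * (K / \<omega> ^ 4 * \<psi> \<omega>)" using P by (intro mult_left_mono) auto
  \<comment> \<open>The 16 comes from (2w)^4. At w = 0 both sides are 0 by the convention for
    division by zero.\<close>
  also have "\<dots> = K / (2 * \<omega>) ^ 4 * (16 * \<bar>m \<omega>\<bar> * \<psi> \<omega>)" by (simp add: power_mult_distrib)
  also have "16 * \<bar>m \<omega>\<bar> * \<psi> \<omega> \<le> \<psi> (2 * \<omega>)"
  proof (cases "\<bar>red2pi \<omega>\<bar> < pi - \<omega>0")
    case True
    have "16 * \<bar>m \<omega>\<bar> * \<psi> \<omega> \<le> 16 * 2 * \<psi> \<omega>"
      using m_le_2 psi_nonneg by (intro mult_mono) auto
    then show ?thesis using psi_good[OF True] by linarith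
  next
    case False
    then have "\<bar>m \<omega>\<bar> \<le> \<eta> * \<bar>cos (\<omega>/2)\<bar> ^ (2 * l)" by (intro m_bad) simp
    also have "\<dots> \<le> \<eta> * \<psi> (2 * \<omega>)" using False eta by (intro mult_left_mono cos_power_le_psi) auto
    finally have "16 * \<bar>m \<omega>\<bar> * \<psi> \<omega> \<le> 16 * (\<eta> * \<psi> (2 * \<omega>)) * 2 ^ 15"
      using psi_le psi_nonneg eta by (intro mult_mono) auto
    \<comment> \<open>Here \<open>\<psi> \<omega>\<close> has been replaced by its maximum 2^15; the
      smallness of \<open>\<eta>\<close> absorbs 16 * 2^15 = 2^19.\<close>
    also have "\<dots> = (2 ^ 19 * \<eta>) * \<psi> (2 * \<omega>)" by simp
    also have "\<dots> \<le> 1 * \<psi> (2 * \<omega>)" using eta psi_nonneg by (intro mult_right_mono) auto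
    finally show ?thesis by simp
  qed
  then have "K / (2 * \<omega>) ^ 4 * (16 * \<bar>m \<omega>\<bar> * \<psi> \<omega>) \<le> K / (2 * \<omega>) ^ 4 * \<psi> (2 * \<omega>)"
    using K' by (intro mult_left_mono)
  finally show ?thesis .
qed

text \<open>Induction over dyadic shells outside the support. In the first shell w/2 lies in the
  zone of \<open>m_bad\<close>, which supplies the factor \<open>\<eta>\<close>;
  \<open>P_step\<close> carries the bound to each further shell.\<close>

lemma P_decay_psi:
  assumes "2 * (pi - \<omega>0) \<le> \<bar>\<omega>\<bar>" "\<bar>\<omega>\<bar> \<le> 2 * (pi - \<omega>0) * 2 ^ Suc n"
  shows "\<bar>P \<omega>\<bar> \<le> (2 ^ 14 * \<eta>) / \<omega> ^ 4 * \<psi> \<omega>"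
  using assms
proof (induction n arbitrary: \<omega>)
  case 0
  define v where "v = \<omega> / 2"
  have v: "pi - \<omega>0 \<le> \<bar>v\<bar>" "\<bar>v\<bar> \<le> 2 * (pi - \<omega>0)" "\<omega> = 2 * v" using 0 by (auto simp: v_def)
  have bad: "pi - \<omega>0 \<le> \<bar>red2pi v\<bar>"
  proof (cases "\<bar>v\<bar> \<le> pi")
    case True
    then show ?thesis using abs_red2pi_eq[of v 0] v by simp
  next
    case False
    define s where "s = (if v > 0 then 1 else - 1 :: int)"
    have *: "\<bar>v - 2 * pi * s\<bar> = 2 * pi - \<bar>v\<bar>" using v False om0 by (auto simp: s_def)
    have "\<bar>red2pi v\<bar> = 2 * pi - \<bar>v\<bar>"
      using abs_red2pi_eq[of "v - 2 * pi * s" s] * False v om0 by (simp add: s_def)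
    \<comment> \<open>Here 2 pi - |v| >= 2 \<open>\<omega>0\<close>, and 2 \<open>\<omega>0\<close>
      >= pi - \<open>\<omega>0\<close> because \<open>\<omega>0\<close> >= pi/3.\<close>
    moreover have "pi - \<omega>0 \<le> 2 * pi - \<bar>v\<bar>" using v(2) om0(1) by (simp add: field_simps)
    ultimately show ?thesis by simp
  qed
  have "\<bar>P v\<bar> \<le> 2" using P_near_phi_center[OF v(2)] phi_range[of v] eta by (auto simp: abs_le_iff)
  moreover have "\<bar>m v\<bar> \<le> \<eta> * \<psi> \<omega>"
    using m_bad[OF bad] mult_left_mono[OF cos_power_le_psi[OF bad] eta(1)] v(3) by simp
  ultimately have "\<bar>m v\<bar> * \<bar>P v\<bar> \<le> (\<eta> * \<psi> \<omega>) * 2"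
    using psi_nonneg eta by (intro mult_mono) auto
  then have *: "\<bar>P \<omega>\<bar> \<le> 2 * \<eta> * \<psi> \<omega>" using P_double[of v] v(3) by (simp add: abs_mult algebra_simps)
  \<comment> \<open>In the first shell |w| <= 4 (pi - \<open>\<omega>0\<close>) <= 8 pi/3 < 9, and 2
    * 9^4 = 13122 <= 2^14 explains the constant.\<close>
  have w: "\<bar>\<omega>\<bar> \<le> 9" "\<bar>\<omega>\<bar> > 0" using 0 om0 pi_approx by auto
  have "\<omega> ^ 4 = \<bar>\<omega>\<bar> ^ 4" by simp
  also have "\<dots> \<le> 9 ^ 4" using w by (intro power_mono) auto
  finally have "2 * \<eta> * \<omega> ^ 4 \<le> 2 * \<eta> * 9 ^ 4" using eta by (intro mult_left_mono) auto
  also have "\<dots> \<le> 2 ^ 14 * \<eta>" using eta by simp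
  finally have "2 * \<eta> \<le> (2 ^ 14 * \<eta>) / \<omega> ^ 4" using w by (simp add: pos_le_divide_eq)
  then have "2 * \<eta> * \<psi> \<omega> \<le> (2 ^ 14 * \<eta>) / \<omega> ^ 4 * \<psi> \<omega>" using psi_nonneg by (rule mult_right_mono)
  with * show ?case by linarith
next
  case (Suc n)
  show ?case
  proof (cases "\<bar>\<omega>\<bar> \<le> 2 * (pi - \<omega>0) * 2 ^ Suc n")
    case True
    then show ?thesis using Suc.IH Suc.prems by blast
  next
    case False
    \<comment> \<open>Beyond the earlier shells, halving the argument still leaves it outside the
      support.\<close>
    have "2 * (pi - \<omega>0) * 2 * 1 \<le> 2 * (pi - \<omega>0) * 2 * 2 ^ n" using om0 by (intro mult_left_mono) auto
    moreover have "\<bar>\<omega>\<bar> > 2 * (pi - \<omega>0) * 2 * 2 ^ n" using False by (simp only: mult.assoc power_Suc not_le)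
    ultimately have "2 * (pi - \<omega>0) \<le> \<bar>\<omega> / 2\<bar>" by simp
    moreover have "\<bar>\<omega> / 2\<bar> \<le> 2 * (pi - \<omega>0) * 2 ^ Suc n" using Suc.prems by simp
    ultimately
    have "\<bar>P (\<omega>/2)\<bar> \<le> (2 ^ 14 * \<eta>) / (\<omega>/2) ^ 4 * \<psi> (\<omega>/2)" by (rule Suc.IH)
    from P_step[OF _ this] eta show ?thesis by simp
  qed
qed

lemma P_decay:
  assumes "2 * (pi - \<omega>0) \<le> \<bar>\<omega>\<bar>"
  shows "\<bar>P \<omega>\<bar> \<le> 2 ^ 29 * \<eta> / \<omega> ^ 4"
proof -
  have pos: "2 * (pi - \<omega>0) > 0" using om0 by simp
  obtain n :: nat where "\<bar>\<omega>\<bar> / (2 * (pi - \<omega>0)) < 2 ^ n"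
    using real_arch_pow[of 2 "\<bar>\<omega>\<bar> / (2 * (pi - \<omega>0))"] by auto
  then have "\<bar>\<omega>\<bar> < 2 ^ n * (2 * (pi - \<omega>0))" using pos by (simp only: pos_divide_less_eq)
  also have "\<dots> \<le> 2 ^ Suc n * (2 * (pi - \<omega>0))" using pos by (intro mult_right_mono power_increasing) auto
  finally have "\<bar>\<omega>\<bar> \<le> 2 * (pi - \<omega>0) * 2 ^ Suc n" by (simp only: mult.commute less_imp_le)
  from P_decay_psi[OF assms this] have "\<bar>P \<omega>\<bar> \<le> (2 ^ 14 * \<eta>) / \<omega> ^ 4 * \<psi> \<omega>" .
  also have "\<dots> \<le> (2 ^ 14 * \<eta>) / \<omega> ^ 4 * 2 ^ 15" using psi_le eta by (intro mult_left_mono) auto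
  finally show ?thesis by simp
qed

text \<open>On the support |w| <= 5, so the weight costs at most 26^2. Outside it |w| >= 1 gives (1
  + w^2)^2 <= 4 w^4, and the Meyer function vanishes there, so the decay of P alone is
  enough.\<close>

lemma P_near_phi: "\<bar>P \<omega> - \<phi> \<omega>\<bar> \<le> 2 ^ 32 * \<eta> / (1 + \<omega>\<^sup>2)\<^sup>2"
proof (cases "\<bar>\<omega>\<bar> \<le> 2 * (pi - \<omega>0)")
  case True
  have "\<bar>\<omega>\<bar> \<le> 5" using True om0 pi_approx by auto
  then have "\<omega>\<^sup>2 \<le> 5\<^sup>2" by (metis abs_ge_zero power2_abs power_mono)
  then have "(1 + \<omega>\<^sup>2)\<^sup>2 \<le> 26\<^sup>2" by (intro power_mono) auto
  then have "11 * \<eta> * (1 + \<omega>\<^sup>2)\<^sup>2 \<le> 11 * \<eta> * 26\<^sup>2" using eta by (intro mult_left_mono) auto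
  also have "\<dots> \<le> 2 ^ 32 * \<eta>" using eta by simp
  finally have "11 * \<eta> \<le> 2 ^ 32 * \<eta> / (1 + \<omega>\<^sup>2)\<^sup>2"
    by (subst pos_le_divide_eq) (simp_all only: weight_pos)
  then show ?thesis using P_near_phi_center[OF True] by linarith
next
  case False
  have "1 \<le> \<bar>\<omega>\<bar>" using False om0 pi_approx by auto
  then have 1: "1 \<le> \<omega>\<^sup>2" by (metis abs_ge_zero one_le_power power2_abs)
  have "(1 + \<omega>\<^sup>2)\<^sup>2 \<le> (2 * \<omega>\<^sup>2)\<^sup>2" using 1 by (intro power_mono) auto
  also have "\<dots> = 4 * \<omega> ^ 4" by (simp add: power_mult_distrib)
  finally have "2 ^ 29 * \<eta> * (1 + \<omega>\<^sup>2)\<^sup>2 \<le> 2 ^ 29 * \<eta> * (4 * \<omega> ^ 4)" using eta by (intro mult_left_mono) auto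
  also have "\<dots> \<le> 2 ^ 32 * \<eta> * \<omega> ^ 4" using eta by simp
  finally have "2 ^ 29 * \<eta> / \<omega> ^ 4 \<le> 2 ^ 32 * \<eta> / (1 + \<omega>\<^sup>2)\<^sup>2"
  proof -
    assume *: "2 ^ 29 * \<eta> * (1 + \<omega>\<^sup>2)\<^sup>2 \<le> 2 ^ 32 * \<eta> * \<omega> ^ 4"
    have "0 < \<omega> ^ 4" using \<open>1 \<le> \<bar>\<omega>\<bar>\<close> by (intro zero_less_power_eq[THEN iffD2]) auto
    then show ?thesis
      using * weight_pos[of \<omega>] by (simp only: pos_divide_le_eq pos_le_divide_eq times_divide_eq_left)
  qed
  then show ?thesis using P_decay[of \<omega>] phi_zero[of \<omega>] False by simp
qed

text \<open>Difference of squares: 2^32 \<open>\<eta>\<close> <= 1 keeps P within 1 of the Meyer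
  function, hence |P + \<open>\<phi>\<close>| <= 3.\<close>

lemma P_sq_near_phi_sq: "\<bar>(P \<omega>)\<^sup>2 - (\<phi> \<omega>)\<^sup>2\<bar> \<le> 3 * 2 ^ 32 * \<eta> / (1 + \<omega>\<^sup>2)\<^sup>2"
proof -
  have w: "1 \<le> (1 + \<omega>\<^sup>2)\<^sup>2" by (intro one_le_power) simp
  have "2 ^ 32 * \<eta> / (1 + \<omega>\<^sup>2)\<^sup>2 \<le> 1"
    using w eta(2) by (subst pos_divide_le_eq) (linarith, argo)
  then have "\<bar>P \<omega> + \<phi> \<omega>\<bar> \<le> 3" using P_near_phi[of \<omega>] phi_range[of \<omega>] by linarith
  then have "\<bar>P \<omega> - \<phi> \<omega>\<bar> * \<bar>P \<omega> + \<phi> \<omega>\<bar> \<le> (2 ^ 32 * \<eta> / (1 + \<omega>\<^sup>2)\<^sup>2) * 3"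
    using P_near_phi eta by (intro mult_mono) auto
  also have "\<bar>P \<omega> - \<phi> \<omega>\<bar> * \<bar>P \<omega> + \<phi> \<omega>\<bar> = \<bar>(P \<omega>)\<^sup>2 - (\<phi> \<omega>)\<^sup>2\<bar>"
    by (simp add: abs_mult[symmetric] power2_eq_square algebra_simps)
  finally show ?thesis by simp
qed

end

subsection \<open>Periodization and orthonormalization\<close>

lemma summable_inverse_1_plus_int_sq: "(\<lambda>k::int. 1 / (1 + (of_int k)\<^sup>2) :: real) summable_on UNIV"
proof -
  have nat: "summable (\<lambda>n. 1 / (1 + (real n)\<^sup>2))"
  proof (rule summable_comparison_test'[where N=1])
    show "summable (\<lambda>n. inverse (real n ^ 2))" by (rule inverse_power_summable) simp
    show "norm (1 / (1 + (real n)\<^sup>2)) \<le> inverse (real n ^ 2)" if "n \<ge> 1" for n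
      using that by (simp add: divide_simps add_pos_nonneg)
  qed
  then have s1: "(\<lambda>n. 1 / (1 + (real n)\<^sup>2)) summable_on UNIV"
    by (subst summable_on_UNIV_nonneg_real_iff) auto
  have s2: "(\<lambda>n. 1 / (1 + (real (Suc n))\<^sup>2)) summable_on UNIV"
    using nat by (subst summable_on_UNIV_nonneg_real_iff, simp, subst summable_Suc_iff)
  define f where "f k = (1 / (1 + (of_int k)\<^sup>2) :: real)" for k :: int
  have "f summable_on (range int)"
    by (subst summable_on_reindex) (use s1 in \<open>auto simp: f_def o_def\<close>)
  \<comment> \<open>The successor keeps 0 from being counted in both halves.\<close>
  moreover have "f summable_on (range (\<lambda>n. - int (Suc n)))"
    by (subst summable_on_reindex) (use s2 in \<open>auto simp: f_def o_def inj_def power2_eq_square algebra_simps\<close>)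
  moreover have "range int \<inter> range (\<lambda>n. - int (Suc n)) = {}" by auto
  ultimately have "f summable_on (range int \<union> range (\<lambda>n. - int (Suc n)))"
    by (rule summable_on_Un_disjoint)
  moreover have "range int \<union> range (\<lambda>n. - int (Suc n)) = UNIV"
  proof -
    have "k \<in> range int \<union> range (\<lambda>n. - int (Suc n))" for k
      by (cases k rule: int_cases) auto
    then show ?thesis by blast
  qed
  ultimately show ?thesis unfolding f_def by simp
qed

definition Wsum :: real where "Wsum = (\<Sum>\<^sub>\<infinity>k\<in>(UNIV::int set). 1 / (1 + (of_int k)\<^sup>2))"



text \<open>A majorant uniform in x: for nonzero k, |x + 2 pi k| >= 2 pi |k| - pi >= |k|. One of the
  two powers of the weight is given away, since the remaining one is already summable.\<close>

lemma weight_shift_le: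
  assumes "\<bar>x\<bar> \<le> pi"
  shows "1 / (1 + (x + 2 * pi * of_int k)\<^sup>2)\<^sup>2 \<le> 1 / (1 + (of_int k)\<^sup>2 :: real)"
proof -
  define y where "y = x + 2 * pi * of_int k"
  have "\<bar>of_int k\<bar> \<le> \<bar>y\<bar>"
  proof (cases "k = 0")
    case False
    then have 1: "\<bar>of_int k :: real\<bar> \<ge> 1" by linarith
    have "\<bar>of_int k :: real\<bar> * 1 \<le> \<bar>of_int k\<bar> * pi" using pi_ge_two by (intro mult_left_mono) linarith+
    moreover have "pi * 1 \<le> pi * \<bar>of_int k\<bar>" using 1 by (intro mult_left_mono) auto
    moreover have "\<bar>2 * pi * of_int k\<bar> \<le> \<bar>y\<bar> + \<bar>x\<bar>" unfolding y_def by simp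
    moreover have "\<bar>2 * pi * of_int k\<bar> = 2 * (pi * \<bar>of_int k\<bar>)" by (simp add: abs_mult)
    ultimately show ?thesis using assms by (simp only: mult.commute[of "\<bar>of_int k\<bar>" pi] mult_1_right)
  qed simp
  then have "(of_int k)\<^sup>2 \<le> y\<^sup>2" by (simp add: abs_le_square_iff)
  moreover have "1 + y\<^sup>2 \<le> (1 + y\<^sup>2)\<^sup>2" by (intro self_le_power) auto
  ultimately have "1 + (of_int k)\<^sup>2 \<le> (1 + y\<^sup>2)\<^sup>2" by linarith
  then show ?thesis unfolding y_def[symmetric] by (intro divide_left_mono mult_pos_pos weight_pos) (auto simp: add_pos_nonneg)
qed

text \<open>Turns an unordered sum over the integers into the limit of a sequence of finite sums,
  from which \<open>Phi\<close> inherits measurability.\<close>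

lemma filterlim_symmetric_int_intervals:
  "filterlim (\<lambda>n. {- int n..int n}) (finite_subsets_at_top UNIV) sequentially"
  unfolding filterlim_finite_subsets_at_top
proof (intro allI impI)
  fix X :: "int set" assume "finite X \<and> X \<subseteq> UNIV"
  then have "finite X" by simp
  then obtain B where "\<And>k. k \<in> X \<Longrightarrow> \<bar>k\<bar> \<le> B"
    using bdd_above_finite[of "abs ` X"] unfolding bdd_above_def by auto
  then have "X \<subseteq> {- int n..int n}" if "n \<ge> nat B" for n
    using that by (force simp: abs_le_iff)
  then show "\<forall>\<^sub>F n in sequentially. finite {- int n..int n} \<and> X \<subseteq> {- int n..int n} \<and> {- int n..int n} \<subseteq> UNIV"
    unfolding eventually_sequentially by blast
qed

context meyer begin

text \<open>The support lies in |w| <= 5, and 676 = (1 + 5^2)^2.\<close>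

lemma phi_sq_le: "(\<phi> \<omega>)\<^sup>2 \<le> 676 * (1 / (1 + \<omega>\<^sup>2)\<^sup>2)"
proof (cases "\<bar>\<omega>\<bar> \<le> 2 * (pi - \<omega>0)")
  case True
  have "\<bar>\<omega>\<bar> \<le> 5" using True om0 pi_approx by auto
  then have "\<omega>\<^sup>2 \<le> 5\<^sup>2" by (metis abs_ge_zero power2_abs power_mono)
  then have w: "(1 + \<omega>\<^sup>2)\<^sup>2 \<le> 26\<^sup>2" by (intro power_mono) auto
  have "(\<phi> \<omega>)\<^sup>2 \<le> 1" using phi_range[of \<omega>] by (simp add: power_le_one)
  also have "1 \<le> 676 * (1 / (1 + \<omega>\<^sup>2)\<^sup>2)"
  proof -
    show ?thesis using w by (simp only: times_divide_eq_right pos_le_divide_eq weight_pos) simp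
  qed
  finally show ?thesis .
qed (simp add: phi_zero)

end

context near_meyer begin

definition Phi :: "real \<Rightarrow> real" where
  "Phi \<omega> = (\<Sum>\<^sub>\<infinity>k\<in>(UNIV::int set). \<bar>P (\<omega> + 2 * pi * of_int k)\<bar>\<^sup>2)"

text \<open>Termwise comparison with the periodized Meyer function, whose squares sum to 1; the
  differences have the summable majorant of \<open>weight_shift_le\<close>.\<close>

lemma Phi_base:
  assumes x: "\<bar>x\<bar> \<le> pi"
  shows "(\<lambda>k::int. \<bar>P (x + 2 * pi * of_int k)\<bar>\<^sup>2) summable_on UNIV"
    and "\<bar>Phi x - 1\<bar> \<le> 3 * 2 ^ 32 * \<eta> * Wsum"
proof -
  define B where "B = 3 * 2 ^ 32 * \<eta>"
  have B: "B \<ge> 0" using eta by (simp add: B_def)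
  define g where "g k = \<bar>P (x + 2 * pi * of_int k)\<bar>\<^sup>2 - (\<phi> (x + 2 * pi * of_int k))\<^sup>2" for k :: int
  have g: "norm (g k) \<le> B * (1 / (1 + (of_int k)\<^sup>2))" for k
  proof -
    have "norm (g k) \<le> B * (1 / (1 + (x + 2 * pi * of_int k)\<^sup>2)\<^sup>2)"
      using P_sq_near_phi_sq[of "x + 2 * pi * of_int k"] by (simp add: g_def B_def)
    also have "\<dots> \<le> B * (1 / (1 + (of_int k)\<^sup>2))"
      using B weight_shift_le[OF x] by (intro mult_left_mono)
    finally show ?thesis .
  qed
  have sB: "(\<lambda>k::int. B * (1 / (1 + (of_int k)\<^sup>2))) summable_on UNIV"
    by (intro summable_on_cmult_right summable_inverse_1_plus_int_sq)
  have ga: "(\<lambda>k. norm (g k)) summable_on UNIV"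
    by (rule Infinite_Sum.abs_summable_on_comparison_test'[OF sB g])
  then have gs: "g summable_on UNIV" by (rule abs_summable_summable)
  have eq: "(\<lambda>k. \<bar>P (x + 2 * pi * of_int k)\<bar>\<^sup>2) = (\<lambda>k::int. g k + (\<phi> (x + 2 * pi * of_int k))\<^sup>2)"
    by (simp add: g_def)
  show "(\<lambda>k::int. \<bar>P (x + 2 * pi * of_int k)\<bar>\<^sup>2) summable_on UNIV"
    unfolding eq by (intro summable_on_add gs phi_periodization_sq x)
  have "Phi x = infsum g UNIV + 1"
    unfolding Phi_def eq using infsum_add[OF gs phi_periodization_sq(2)[OF x]] phi_periodization_sq(1)[OF x] by simp
  then have "\<bar>Phi x - 1\<bar> = norm (infsum g UNIV)" by simp
  also have "\<dots> \<le> infsum (\<lambda>k. norm (g k)) UNIV" by (rule norm_infsum_bound[OF ga])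
  also have "\<dots> \<le> infsum (\<lambda>k::int. B * (1 / (1 + (of_int k)\<^sup>2))) UNIV"
    by (rule infsum_mono[OF ga sB]) (rule g)
  also have "\<dots> = B * Wsum" unfolding Wsum_def by (rule infsum_cmult_right')
  finally show "\<bar>Phi x - 1\<bar> \<le> 3 * 2 ^ 32 * \<eta> * Wsum" by (simp add: B_def)
qed

text \<open>A translation of the summation index moves any point into [-pi, pi], where
  \<open>Phi_base\<close> applies.\<close>

lemma Phi_summable: "(\<lambda>k::int. \<bar>P (\<omega> + 2 * pi * of_int k)\<bar>\<^sup>2) summable_on UNIV"
  and Phi_near_1: "\<bar>Phi \<omega> - 1\<bar> \<le> 3 * 2 ^ 32 * \<eta> * Wsum"
proof -
  define x where "x = red2pi \<omega>"
  define n where "n = \<lfloor>(\<omega> + pi) / (2*pi)\<rfloor>"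
  have w: "\<omega> = x + 2 * pi * of_int n" unfolding x_def n_def by (rule red2pi_decomp)
  have x: "\<bar>x\<bar> \<le> pi" unfolding x_def by (rule abs_red2pi_le)
  have h: "\<bar>P (x + 2 * pi * of_int (k + n))\<bar>\<^sup>2 = \<bar>P (\<omega> + 2 * pi * of_int k)\<bar>\<^sup>2" for k
    by (simp add: w algebra_simps)
  have "(\<lambda>k::int. \<bar>P (\<omega> + 2 * pi * of_int k)\<bar>\<^sup>2) summable_on UNIV \<longleftrightarrow>
     (\<lambda>k::int. \<bar>P (x + 2 * pi * of_int k)\<bar>\<^sup>2) summable_on UNIV"
    by (rule summable_on_reindex_bij_witness[where i="\<lambda>k. k - n" and j="\<lambda>k. k + n"]) (simp_all only: h, auto)
  then show "(\<lambda>k::int. \<bar>P (\<omega> + 2 * pi * of_int k)\<bar>\<^sup>2) summable_on UNIV"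
    using Phi_base(1)[OF x] by simp
  have "Phi \<omega> = Phi x" unfolding Phi_def
    by (rule infsum_reindex_bij_witness[where i="\<lambda>k. k - n" and j="\<lambda>k. k + n"]) (simp_all only: h, auto)
  then show "\<bar>Phi \<omega> - 1\<bar> \<le> 3 * 2 ^ 32 * \<eta> * Wsum" using Phi_base(2)[OF x] by simp
qed

lemma Phi_meas: "Phi \<in> borel_measurable borel"
proof (rule borel_measurable_LIMSEQ_real)
  show "(\<lambda>n. \<Sum>k\<in>{- int n..int n}. \<bar>P (\<omega> + 2 * pi * of_int k)\<bar>\<^sup>2) \<longlonglongrightarrow> Phi \<omega>" for \<omega>
    using filterlim_compose[OF has_sum_infsum[OF Phi_summable, unfolded has_sum_def] filterlim_symmetric_int_intervals]
    unfolding Phi_def .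
  show "(\<lambda>\<omega>. \<Sum>k\<in>{- int n..int n}. \<bar>P (\<omega> + 2 * pi * of_int k)\<bar>\<^sup>2) \<in> borel_measurable borel" for n
    by (intro borel_measurable_sum borel_measurable_power borel_measurable_abs measurable_compose[OF _ P_meas]) measurable
qed



text \<open>The smallness assumption keeps \<open>Phi\<close> above 1/2, so dividing by it costs a
  factor 2. The error then splits into that of P squared and that of \<open>Phi\<close> weighted by
  the squared Meyer function.\<close>

lemma orth_sq_near:
  assumes small: "3 * 2 ^ 32 * \<eta> * Wsum \<le> 1/2"
  shows "\<bar>(P \<omega> / sqrt (Phi \<omega>))\<^sup>2 - (\<phi> \<omega>)\<^sup>2\<bar> \<le> 6 * 2 ^ 32 * (1 + 676 * Wsum) * \<eta> * (1 / (1 + \<omega>\<^sup>2)\<^sup>2)"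
proof -
  define w where "w = 1 / (1 + \<omega>\<^sup>2)\<^sup>2"
  define B where "B = 3 * 2 ^ 32 * \<eta>"
  have B: "B \<ge> 0" using eta by (simp add: B_def)
  have P1: "\<bar>Phi \<omega> - 1\<bar> \<le> B * Wsum" using Phi_near_1 by (simp add: B_def)
  then have P2: "Phi \<omega> \<ge> 1/2" using small unfolding B_def by linarith
  have d: "\<bar>(P \<omega>)\<^sup>2 - (\<phi> \<omega>)\<^sup>2\<bar> \<le> B * w" using P_sq_near_phi_sq[of \<omega>] by (simp add: B_def w_def)
  have "(P \<omega> / sqrt (Phi \<omega>))\<^sup>2 = (P \<omega>)\<^sup>2 / Phi \<omega>" using P2 by (simp add: power_divide)
  then have "(P \<omega> / sqrt (Phi \<omega>))\<^sup>2 - (\<phi> \<omega>)\<^sup>2 = (((P \<omega>)\<^sup>2 - (\<phi> \<omega>)\<^sup>2) - (\<phi> \<omega>)\<^sup>2 * (Phi \<omega> - 1)) / Phi \<omega>"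
    using P2 by (simp add: field_simps)
  then have "\<bar>(P \<omega> / sqrt (Phi \<omega>))\<^sup>2 - (\<phi> \<omega>)\<^sup>2\<bar>
      = \<bar>((P \<omega>)\<^sup>2 - (\<phi> \<omega>)\<^sup>2) - (\<phi> \<omega>)\<^sup>2 * (Phi \<omega> - 1)\<bar> / Phi \<omega>"
    using P2 by simp
  also have "\<dots> \<le> \<bar>((P \<omega>)\<^sup>2 - (\<phi> \<omega>)\<^sup>2) - (\<phi> \<omega>)\<^sup>2 * (Phi \<omega> - 1)\<bar> / (1/2)"
    using P2 by (intro divide_left_mono) auto
  also have "\<dots> \<le> 2 * (\<bar>(P \<omega>)\<^sup>2 - (\<phi> \<omega>)\<^sup>2\<bar> + (\<phi> \<omega>)\<^sup>2 * \<bar>Phi \<omega> - 1\<bar>)"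
    using abs_triangle_ineq4[of "(P \<omega>)\<^sup>2 - (\<phi> \<omega>)\<^sup>2" "(\<phi> \<omega>)\<^sup>2 * (Phi \<omega> - 1)"] by (simp add: abs_mult)
  also have "\<dots> \<le> 2 * (B * w + (676 * w) * (B * Wsum))"
    using d P1 phi_sq_le[of \<omega>] unfolding w_def[symmetric]
    by (intro mult_left_mono add_mono mult_mono) (auto simp: w_def)
  also have "\<dots> = 6 * 2 ^ 32 * (1 + 676 * Wsum) * \<eta> * w" by (simp add: B_def algebra_simps)
  finally show ?thesis unfolding w_def .
qed

end

subsection \<open>Moments\<close>

definition moment :: "nat \<Rightarrow> (real \<Rightarrow> real) \<Rightarrow> real" where
  "moment p f = (\<integral>\<omega>. \<omega> ^ p * (f \<omega>)\<^sup>2 \<partial>lborel)"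

lemma integrable_inverse_1_plus_sq: "integrable lborel (\<lambda>x::real. 1 / (1 + x\<^sup>2))"
  using integrable_inverse_1_plus_square
  by (simp add: set_integrable_def einterval_def inverse_eq_divide)

lemma abs_power_le_1_plus_sq: "p \<le> 2 \<Longrightarrow> \<bar>x ^ p\<bar> \<le> 1 + (x::real)\<^sup>2"
proof -
  assume "p \<le> 2"
  then consider "p = 0" | "p = 1" | "p = 2" by linarith
  then show ?thesis
  proof cases
    case 2
    have "0 \<le> (\<bar>x\<bar> - 1)\<^sup>2" by simp
    then show ?thesis using 2 by (simp add: power2_eq_square algebra_simps)
  qed auto
qed

text \<open>The reason for the squared weight: a power of order at most two uses up one factor 1 +
  x^2, and the other still gives an integrable bound.\<close>

lemma power_weight_le:
  assumes "p \<le> 2" "\<bar>a\<bar> \<le> C * (1 / (1 + x\<^sup>2)\<^sup>2)"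
  shows "\<bar>x ^ p * a\<bar> \<le> C * (1 / (1 + (x::real)\<^sup>2))"
proof -
  have pos: "0 < 1 + x\<^sup>2" by (simp add: add_pos_nonneg)
  have "\<bar>x ^ p * a\<bar> \<le> (1 + x\<^sup>2) * (C * (1 / (1 + x\<^sup>2)\<^sup>2))"
    unfolding abs_mult using assms abs_power_le_1_plus_sq by (intro mult_mono) auto
  also have "\<dots> = C * (1 / (1 + x\<^sup>2))" using pos by (simp add: power2_eq_square)
  finally show ?thesis .
qed

lemma moment_integrable:
  fixes f :: "real \<Rightarrow> real"
  assumes [measurable]: "f \<in> borel_measurable borel"
    and f: "\<And>x. (f x)\<^sup>2 \<le> C * (1 / (1 + x\<^sup>2)\<^sup>2)" and p: "p \<le> 2"
  shows "integrable lborel (\<lambda>x. x ^ p * (f x)\<^sup>2)"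
proof (rule Bochner_Integration.integrable_bound)
  show "integrable lborel (\<lambda>x. C * (1 / (1 + x\<^sup>2)))"
    by (intro Bochner_Integration.integrable_mult_right integrable_inverse_1_plus_sq)
  show "AE x in lborel. norm (x ^ p * (f x)\<^sup>2) \<le> norm (C * (1 / (1 + x\<^sup>2)))"
  proof (intro AE_I2)
    fix x
    have "\<bar>x ^ p * (f x)\<^sup>2\<bar> \<le> C * (1 / (1 + x\<^sup>2))"
      using f by (intro power_weight_le p) simp
    then show "norm (x ^ p * (f x)\<^sup>2) \<le> norm (C * (1 / (1 + x\<^sup>2)))"
      unfolding real_norm_def by linarith
  qed
qed measurable

lemma moment_diff_le:
  assumes fm: "f \<in> borel_measurable borel" and f: "\<And>x. (f x)\<^sup>2 \<le> C * (1 / (1 + x\<^sup>2)\<^sup>2)"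
    and gm: "g \<in> borel_measurable borel" and g: "\<And>x. (g x)\<^sup>2 \<le> C' * (1 / (1 + x\<^sup>2)\<^sup>2)"
    and fg: "\<And>x. \<bar>(f x)\<^sup>2 - (g x)\<^sup>2\<bar> \<le> K * (1 / (1 + x\<^sup>2)\<^sup>2)" and p: "p \<le> 2"
  shows "\<bar>moment p f - moment p g\<bar> \<le> K * (\<integral>x. 1 / (1 + x\<^sup>2) \<partial>lborel)"
proof -
  note fi = moment_integrable[OF fm f p] and gi = moment_integrable[OF gm g p]
  have eq: "moment p f - moment p g = (\<integral>x. x ^ p * ((f x)\<^sup>2 - (g x)\<^sup>2) \<partial>lborel)"
    unfolding moment_def Bochner_Integration.integral_diff[OF fi gi, symmetric]
    by (simp add: right_diff_distrib)
  have i: "integrable lborel (\<lambda>x. x ^ p * ((f x)\<^sup>2 - (g x)\<^sup>2))"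
    using Bochner_Integration.integrable_diff[OF fi gi] by (simp add: right_diff_distrib)
  have "norm (\<integral>x. x ^ p * ((f x)\<^sup>2 - (g x)\<^sup>2) \<partial>lborel) \<le> (\<integral>x. K * (1 / (1 + x\<^sup>2)) \<partial>lborel)"
  proof (rule Bochner_Integration.integral_norm_bound_integral[OF i])
    show "integrable lborel (\<lambda>x. K * (1 / (1 + x\<^sup>2)))"
      by (intro Bochner_Integration.integrable_mult_right integrable_inverse_1_plus_sq)
    show "norm (x ^ p * ((f x)\<^sup>2 - (g x)\<^sup>2)) \<le> K * (1 / (1 + x\<^sup>2))" for x
      using power_weight_le[OF p fg] by simp
  qed
  then show ?thesis unfolding eq by (simp only: integral_mult_right_zero real_norm_def)
qed

text \<open>The variance formula, obtained by expanding the square about the centre. It reduces the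
  radius to quotients of three moments.\<close>

lemma freq_radius_sq_moments:
  assumes fm: "f \<in> borel_measurable borel" and f: "\<And>x. (f x)\<^sup>2 \<le> C * (1 / (1 + x\<^sup>2)\<^sup>2)"
    and nz: "moment 0 f \<noteq> 0"
  shows "freq_radius_sq f = moment 2 f / moment 0 f - (moment 1 f / moment 0 f)\<^sup>2"
proof -
  note i = moment_integrable[OF fm f]
  define c where "c = moment 1 f / moment 0 f"
  have c: "freq_center f = c" "L2sq f = moment 0 f"
    by (simp_all add: freq_center_def L2sq_def moment_def c_def)
  have "(\<integral>x. (x - c)\<^sup>2 * (f x)\<^sup>2 \<partial>lborel)
      = (\<integral>x. x ^ 2 * (f x)\<^sup>2 - 2 * c * (x ^ 1 * (f x)\<^sup>2) + c\<^sup>2 * (x ^ 0 * (f x)\<^sup>2) \<partial>lborel)"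
    by (rule Bochner_Integration.integral_cong) (auto simp: power2_eq_square algebra_simps)
  also have "\<dots> = moment 2 f - 2 * c * moment 1 f + c\<^sup>2 * moment 0 f"
    unfolding moment_def
    using i[of 0] i[of 1] i[of 2]
    by (subst Bochner_Integration.integral_add Bochner_Integration.integral_diff integral_mult_right_zero;
        (intro Bochner_Integration.integrable_diff Bochner_Integration.integrable_mult_right)?; simp)+
  finally show ?thesis
    unfolding freq_radius_sq_def c using nz by (simp add: c_def field_simps power2_eq_square)
qed

text \<open>Uses x/y - a/b = (b(x - a) - a(y - b)) / (y b). Since e tends to 0, y tends to b, so the
  denominator stays away from 0.\<close>

lemma bigo_quotient_diff:
  fixes x y :: "nat \<Rightarrow> real"
  assumes x: "(\<lambda>n. x n - a) \<in> O(e)" and y: "(\<lambda>n. y n - b) \<in> O(e)" and e: "e \<in> o(\<lambda>_. 1)" and b: "b \<noteq> 0"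
  shows "(\<lambda>n. x n / y n - a / b) \<in> O(e)"
proof -
  have "(\<lambda>n. y n - b) \<longlonglongrightarrow> 0"
    using smalloD_tendsto[OF landau_o.big_small_trans[OF y e]] by simp
  then have yb: "y \<longlonglongrightarrow> b" by (simp add: LIM_zero_iff)
  then have ev: "eventually (\<lambda>n. y n \<noteq> 0) sequentially" using b by (rule tendsto_imp_eventually_ne)
  have "(\<lambda>n. 1 / (y n * b)) \<longlonglongrightarrow> 1 / (b * b)" using b by (intro tendsto_intros yb) auto
  then have inv: "(\<lambda>n. 1 / (y n * b)) \<in> O(\<lambda>_. 1)" by (intro bigoI_tendsto) auto
  have num: "(\<lambda>n. b * (x n - a) - a * (y n - b)) \<in> O(e)" using x y by (intro sum_in_bigo) auto
  have "(\<lambda>n. (b * (x n - a) - a * (y n - b)) * (1 / (y n * b))) \<in> O(\<lambda>n. e n * 1)"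
    by (rule landau_o.big.mult[OF num inv])
  then have *: "(\<lambda>n. (b * (x n - a) - a * (y n - b)) * (1 / (y n * b))) \<in> O(e)" by simp
  have "eventually (\<lambda>n. (b * (x n - a) - a * (y n - b)) * (1 / (y n * b)) = x n / y n - a / b) sequentially"
    using ev by eventually_elim (use b in \<open>simp add: field_simps\<close>)
  from landau_o.big.in_cong[THEN iffD1, OF this *] show ?thesis .
qed

subsection \<open>Masks obtained from summation methods\<close>

text \<open>Continuity on the compact interval makes the set bounded, so that the supremum really is
  an upper bound.\<close>

lemma abs_le_supC:
  assumes "continuous_on {-pi..pi} h" "\<bar>x\<bar> \<le> pi"
  shows "\<bar>h x\<bar> \<le> supC h"
  unfolding supC_def
proof (rule cSUP_upper)
  show "x \<in> {-pi..pi}" using assms by auto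
  have "compact ((\<lambda>x. \<bar>h x\<bar>) ` {-pi..pi})"
    using assms(1) by (intro compact_continuous_image continuous_intros) auto
  then show "bdd_above ((\<lambda>x. \<bar>h x\<bar>) ` {-pi..pi})"
    by (intro bounded_imp_bdd_above compact_imp_bounded)
qed

text \<open>Integration by parts. The boundary terms cancel by f(-pi) = f(pi) for the cosine
  coefficients, and because sin(k pi) = 0 for the sine coefficients.\<close>

lemma fourier_deriv:
  assumes f: "\<And>x. \<bar>x\<bar> \<le> pi \<Longrightarrow> (f has_real_derivative f' x) (at x)"
    and cf': "continuous_on {-pi..pi} f'" and per: "f (- pi) = f pi"
  shows "fourier_a f' k = real k * fourier_b f k" "fourier_b f' k = - (real k * fourier_a f k)"
proof -
  have cf: "continuous_on {-pi..pi} f"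
    by (intro continuous_at_imp_continuous_on ballI DERIV_isCont[OF f]) auto

  have i: "(\<lambda>t. f t * cos (real k * t)) integrable_on {-pi..pi}" "(\<lambda>t. f t * sin (real k * t)) integrable_on {-pi..pi}"
    "(\<lambda>t. f' t * cos (real k * t)) integrable_on {-pi..pi}" "(\<lambda>t. f' t * sin (real k * t)) integrable_on {-pi..pi}"
    by (intro integrable_continuous_real continuous_intros cf cf')+
  have s: "sin (real k * pi) = 0" using sin_npi by simp
  have "((\<lambda>t. f' t * cos (real k * t) - real k * (f t * sin (real k * t))) has_integral
      (f pi * cos (real k * pi) - f (-pi) * cos (real k * (-pi)))) {-pi..pi}"
  proof (rule fundamental_theorem_of_calculus)
    fix x assume x: "x \<in> {-pi..pi}"
    then have "(f has_real_derivative f' x) (at x within {-pi..pi})"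
      using f[of x] by (auto simp: abs_le_iff intro: has_field_derivative_at_within)
    then have "((\<lambda>t. f t * cos (real k * t)) has_real_derivative f' x * cos (real k * x) - real k * (f x * sin (real k * x))) (at x within {-pi..pi})"
      by (auto intro!: derivative_eq_intros simp: algebra_simps)
    then show "((\<lambda>t. f t * cos (real k * t)) has_vector_derivative f' x * cos (real k * x) - real k * (f x * sin (real k * x))) (at x within {-pi..pi})"
      by (simp add: has_real_derivative_iff_has_vector_derivative)
  qed simp
  from has_integral_unique[OF this has_integral_diff[OF integrable_integral[OF i(3)]
        has_integral_mult_right[OF integrable_integral[OF i(2)], of "real k"]]]
  have "integral {-pi..pi} (\<lambda>t. f' t * cos (real k * t)) = real k * integral {-pi..pi} (\<lambda>t. f t * sin (real k * t))"
    using per by simp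
  then show "fourier_a f' k = real k * fourier_b f k" by (simp add: fourier_a_def fourier_b_def)
  have "((\<lambda>t. f' t * sin (real k * t) + real k * (f t * cos (real k * t))) has_integral
      (f pi * sin (real k * pi) - f (-pi) * sin (real k * (-pi)))) {-pi..pi}"
  proof (rule fundamental_theorem_of_calculus)
    fix x assume x: "x \<in> {-pi..pi}"
    then have "(f has_real_derivative f' x) (at x within {-pi..pi})"
      using f[of x] by (auto simp: abs_le_iff intro: has_field_derivative_at_within)
    then have "((\<lambda>t. f t * sin (real k * t)) has_real_derivative f' x * sin (real k * x) + real k * (f x * cos (real k * x))) (at x within {-pi..pi})"
      by (auto intro!: derivative_eq_intros simp: algebra_simps)
    then show "((\<lambda>t. f t * sin (real k * t)) has_vector_derivative f' x * sin (real k * x) + real k * (f x * cos (real k * x))) (at x within {-pi..pi})"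
      by (simp add: has_real_derivative_iff_has_vector_derivative)
  qed simp
  from has_integral_unique[OF this has_integral_add[OF integrable_integral[OF i(4)]
        has_integral_mult_right[OF integrable_integral[OF i(1)], of "real k"]]]
  have "integral {-pi..pi} (\<lambda>t. f' t * sin (real k * t)) = - (real k * integral {-pi..pi} (\<lambda>t. f t * cos (real k * t)))"
    using s by simp
  then show "fourier_b f' k = - (real k * fourier_a f k)" by (simp add: fourier_a_def fourier_b_def)
qed

text \<open>A summation method acts as a Fourier multiplier and so commutes with differentiation.
  Thus \<open>\<gamma>\<close> controls the derivative of the approximation error.\<close>

lemma lin_sum_deriv:
  assumes "\<And>x. \<bar>x\<bar> \<le> pi \<Longrightarrow> (f has_real_derivative f' x) (at x)"
    and "continuous_on {-pi..pi} f'" and "f (- pi) = f pi"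
  shows "(lin_sum lam n f has_real_derivative lin_sum lam n f' x) (at x)"
proof -
  note F = fourier_deriv[OF assms]
  have "((\<lambda>\<omega>. lam n k * (fourier_a f k * cos (real k * \<omega>) + fourier_b f k * sin (real k * \<omega>))) has_real_derivative
        lam n k * (fourier_a f' k * cos (real k * x) + fourier_b f' k * sin (real k * x))) (at x)" for k
    by (auto intro!: derivative_eq_intros simp: F algebra_simps)
  then have "((\<lambda>\<omega>. fourier_a f 0 / 2 + (\<Sum>k=1..n. lam n k * (fourier_a f k * cos (real k * \<omega>) + fourier_b f k * sin (real k * \<omega>))))
      has_real_derivative 0 + (\<Sum>k=1..n. lam n k * (fourier_a f' k * cos (real k * x) + fourier_b f' k * sin (real k * x)))) (at x)"
    by (intro DERIV_add DERIV_const DERIV_sum)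
  \<comment> \<open>The case k = 0 shows that the constant term for f' vanishes.\<close>
  then show ?thesis unfolding lin_sum_def[abs_def] using F(1)[of 0] by simp
qed

lemma lin_sum_red2pi: "lin_sum lam n f (red2pi \<omega>) = lin_sum lam n f \<omega>"
proof -
  define j where "j = \<lfloor>(\<omega> + pi) / (2*pi)\<rfloor>"
  have "real k * red2pi \<omega> = real k * \<omega> - 2 * pi * of_int (int k * j)" for k
    unfolding red2pi_def j_def by (simp add: algebra_simps)
  then have "cos (real k * red2pi \<omega>) = cos (real k * \<omega>)" "sin (real k * red2pi \<omega>) = sin (real k * \<omega>)" for k
    by (simp_all only: cos_diff sin_diff cos_int_2pin sin_int_2pin mult_1_right mult_zero_right diff_zero add_0_right)
  then show ?thesis unfolding lin_sum_def by simp
qed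

text \<open>The even exponent removes the sign that cos(w/2) picks up under a shift by 2 pi.\<close>

lemma cos_half_power_red2pi: "cos (red2pi \<omega> / 2) ^ (2 * l) = cos (\<omega> / 2) ^ (2 * l)"
proof -
  have "\<bar>cos (red2pi \<omega> / 2)\<bar> = \<bar>cos (\<omega> / 2)\<bar>"
    using abs_cos_half_red2pi[of \<omega>] abs_cos_half_red2pi[of "red2pi \<omega>"] red2pi_id[OF red2pi_bounds] by simp
  then have "(cos (red2pi \<omega> / 2))\<^sup>2 = (cos (\<omega> / 2))\<^sup>2" by (simp add: power2_eq_iff abs_eq_iff)
  then show ?thesis by (simp add: power_mult)
qed

section \<open>Regularity of the quotient mask and its approximation\<close>

context meyer begin

abbreviation ml :: "nat \<Rightarrow> real \<Rightarrow> real" where "ml \<equiv> meyer_mask_l \<theta> \<omega>0"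

text \<open>The denominator vanishes at odd multiples of pi, but the numerator is identically 0 for
  |x| > pi - \<open>\<omega>0\<close>. The open sets |x| < pi and |x| > pi -
  \<open>\<omega>0\<close> cover the line, and smoothness is clear on each.\<close>

lemma ml_C1:
  obtains D where "\<And>x. \<bar>x\<bar> \<le> pi \<Longrightarrow> (ml l has_real_derivative D x) (at x)" "continuous_on UNIV D"
proof -
  obtain \<phi>1 where p: "\<And>x. (\<phi> has_real_derivative \<phi>1 x) (at x)" and cp: "continuous_on UNIV \<phi>1"
    using phi_C1 by blast
  have c\<phi>: "continuous_on UNIV \<phi>" using p DERIV_isCont continuous_at_imp_continuous_on by blast
  define G where "G x = \<phi> (2 * x) / cos (x/2) ^ (2 * l)" for x
  \<comment> \<open>The quotient rule. For l = 0 the exponent 2l - 1 truncates to 0, but its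
    coefficient is 0 as well.\<close>
  define D where "D x = (\<phi>1 (2 * x) * 2 * cos (x/2) ^ (2 * l)
      - \<phi> (2 * x) * (real (2 * l) * (- sin (x/2) * (1/2) * cos (x/2) ^ (2 * l - 1)))) / (cos (x/2) ^ (2 * l) * cos (x/2) ^ (2 * l))" for x
  have op: "open {x. \<bar>x\<bar> > pi - \<omega>0}" by (intro open_Collect_less continuous_intros)
  have zero: "G x = 0" "D x = 0" if "\<bar>x\<bar> > pi - \<omega>0" for x
  proof -
    show "G x = 0" using that by (simp add: G_def phi_zero)
    have op': "open {x. \<bar>x\<bar> > 2 * (pi - \<omega>0)}" by (intro open_Collect_less continuous_intros)
    have "(\<phi> has_real_derivative 0) (at (2 * x))"
      by (rule has_field_derivative_transform_within_open[OF DERIV_const[of 0] op'])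
        (use that in \<open>auto simp: phi_zero\<close>)
    then have "\<phi>1 (2 * x) = 0" using p DERIV_unique by blast
    then show "D x = 0" using that by (simp add: D_def phi_zero)
  qed
  have cos_ne: "cos (x/2) \<noteq> 0" if "\<bar>x\<bar> < pi" for x
    using that cos_gt_zero_pi[of "x/2"] by (auto simp: abs_less_iff)
  have G': "(G has_real_derivative D x) (at x)" for x
  proof (cases "\<bar>x\<bar> < pi")
    case True
    have "((\<lambda>x. \<phi> (2 * x)) has_real_derivative \<phi>1 (2 * x) * 2) (at x)"
      by (rule DERIV_chain'[where f="\<lambda>x. 2 * x" and g=\<phi>, OF _ p, THEN DERIV_cong]) (auto intro!: derivative_eq_intros)
    moreover have "((\<lambda>x. cos (x/2) ^ (2 * l)) has_real_derivative (real (2 * l) * (- sin (x/2) * (1/2) * cos (x/2) ^ (2 * l - 1)))) (at x)"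
      by (rule derivative_eq_intros refl | simp)+
    ultimately show ?thesis
      unfolding G_def[abs_def] D_def by (rule DERIV_divide) (use cos_ne[OF True] in simp)
  next
    case False
    then have x: "\<bar>x\<bar> > pi - \<omega>0" using om0_pos by linarith
    have "(G has_real_derivative 0) (at x)"
      by (rule has_field_derivative_transform_within_open[OF DERIV_const[of 0] op])
        (use x zero(1) in auto)
    then show ?thesis using zero(2)[OF x] by simp
  qed
  have "continuous_on ({x. \<bar>x\<bar> < pi} \<union> {x. \<bar>x\<bar> > pi - \<omega>0}) D"
  proof (rule continuous_on_open_Un)
    show "open {x::real. \<bar>x\<bar> < pi}" by (intro open_Collect_less continuous_intros)
    show "open {x. \<bar>x\<bar> > pi - \<omega>0}" by (rule op)
    show "continuous_on {x. \<bar>x\<bar> < pi} D"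
      unfolding D_def using cos_ne
      by (intro continuous_intros continuous_on_compose2[OF cp] continuous_on_compose2[OF c\<phi>]) auto
    show "continuous_on {x. \<bar>x\<bar> > pi - \<omega>0} D"
      using zero(2) by (subst continuous_on_cong[OF refl, of _ _ "\<lambda>_. 0"]) auto
  qed
  moreover have "{x. \<bar>x\<bar> < pi} \<union> {x. \<bar>x\<bar> > pi - \<omega>0} = UNIV" using om0_pos by auto
  ultimately have cD: "continuous_on UNIV D" by simp
  \<comment> \<open>G uses \<open>\<phi> (2 * x)\<close> instead of the periodic mask; the two agree
    on an open set containing [-pi, pi].\<close>
  have "(ml l has_real_derivative D x) (at x)" if "\<bar>x\<bar> \<le> pi" for x
  proof (rule has_field_derivative_transform_within_open[OF G'])
    show "open {x. \<bar>x\<bar> < pi + \<omega>0}" by (intro open_Collect_less continuous_intros)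
    show "x \<in> {x. \<bar>x\<bar> < pi + \<omega>0}" using that om0_pos by simp
    show "G y = ml l y" if "y \<in> {x. \<bar>x\<bar> < pi + \<omega>0}" for y
      using that by (simp add: G_def meyer_mask_l_def mM_eq_wide)
  qed
  then show ?thesis using cD that by blast
qed

lemma cos_times_ml:
  assumes "\<bar>x\<bar> \<le> pi" shows "cos (x/2) ^ (2 * l) * ml l x = mM x"
proof (cases "cos (x/2) = 0")
  case True
  have "\<bar>x\<bar> = pi"
    using True assms cos_gt_zero_pi[of "x/2"] by force
  then have "mM x = 0" using om0_pos by (simp add: mM_eq phi_zero abs_mult)
  then show ?thesis by (simp add: meyer_mask_l_def)
qed (simp add: meyer_mask_l_def)

lemma ml_0: "ml l 0 = 1"
  using cos_times_ml[of 0 l] om0_pos by (simp add: mM_eq phi_one)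

text \<open>Supplies the hypotheses of \<open>near_meyer\<close>. With u = \<open>ml l\<close> + g,
  every mask error is an expression in cos(x/2)^(2l) g and g(0), divided by u(0), whose modulus is
  at least c. Near the origin the mean value inequality gives the linear bound.\<close>

lemma approximate_mask_near:
  fixes lam :: "nat \<Rightarrow> nat \<Rightarrow> real" and n l :: nat and c :: real
  defines "u \<equiv> lin_sum lam n (ml l)"
  defines "\<alpha> \<equiv> supC (\<lambda>\<omega>. u \<omega> - ml l \<omega>)"
    and "\<gamma> \<equiv> supC (\<lambda>\<omega>. lin_sum lam n (deriv (ml l)) \<omega> - deriv (ml l) \<omega>)"
  assumes l: "l \<ge> 3" and c: "0 < c" "c \<le> \<bar>u 0\<bar>"
    and small: "2^32 * (2 * (real l * \<alpha> + \<gamma>) / c) \<le> 1"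
  shows "near_meyer \<theta> \<omega>0 (mask_l l u) (2 * (real l * \<alpha> + \<gamma>) / c) l"
    and "0 \<le> \<alpha>" "0 \<le> \<gamma>"
proof -
  obtain D where D: "\<And>x. \<bar>x\<bar> \<le> pi \<Longrightarrow> (ml l has_real_derivative D x) (at x)" and cD: "continuous_on UNIV D"
    using ml_C1[of l] by blast
  define d where "d = deriv (ml l)"
  have dD: "d x = D x" if "\<bar>x\<bar> \<le> pi" for x unfolding d_def using D[OF that] by (rule DERIV_imp_deriv)
  have mld: "(ml l has_real_derivative d x) (at x)" if "\<bar>x\<bar> \<le> pi" for x using D that dD by simp
  have cd: "continuous_on {-pi..pi} d"
    using continuous_on_subset[OF cD, of "{-pi..pi}"] dD by (subst continuous_on_cong[OF refl, of _ _ D]) auto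
  have per: "ml l (- pi) = ml l pi"
    by (simp add: meyer_mask_l_def mM_eq phi_abs)
  define u1 where "u1 = lin_sum lam n d"
  have u': "(u has_real_derivative u1 x) (at x)" for x
    unfolding u_def u1_def by (rule lin_sum_deriv[OF mld cd per])
  have cu: "continuous_on A u" for A using u' DERIV_isCont continuous_at_imp_continuous_on by blast
  have cu1: "continuous_on A u1" for A unfolding u1_def lin_sum_def[abs_def] by (intro continuous_intros)
  define g where "g x = u x - ml l x" for x
  have g': "(g has_real_derivative u1 x - d x) (at x)" if "\<bar>x\<bar> \<le> pi" for x
    unfolding g_def[abs_def] by (intro DERIV_diff u' mld that)
  have cml: "continuous_on {-pi..pi} (ml l)"
    by (intro continuous_at_imp_continuous_on ballI DERIV_isCont[OF mld]) auto
  have ga: "\<bar>g x\<bar> \<le> \<alpha>" if "\<bar>x\<bar> \<le> pi" for x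
    unfolding g_def \<alpha>_def by (rule abs_le_supC[OF _ that]) (intro continuous_intros cu cml)
  have gg: "\<bar>u1 x - d x\<bar> \<le> \<gamma>" if "\<bar>x\<bar> \<le> pi" for x
    unfolding \<gamma>_def d_def[symmetric] u1_def[symmetric] by (rule abs_le_supC[OF _ that]) (intro continuous_intros cu1 cd)
  show a0: "0 \<le> \<alpha>" using ga[of 0] by simp
  show g0: "0 \<le> \<gamma>" using gg[of 0] by simp
  have u0: "u 0 \<noteq> 0" using c by auto
  define \<mu> where "\<mu> = real l * \<alpha> + \<gamma>"
  have mu: "\<alpha> \<le> \<mu>" "0 \<le> \<mu>"
  proof -
    have "1 * \<alpha> \<le> real l * \<alpha>" using l a0 by (intro mult_right_mono) auto
    then show "\<alpha> \<le> \<mu>" using g0 by (simp add: \<mu>_def)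
    then show "0 \<le> \<mu>" using a0 by simp
  qed
  have div_c: "\<bar>t / u 0\<bar> \<le> b / c" if "\<bar>t\<bar> \<le> b" for t b
    unfolding abs_divide using that c by (intro frac_le) auto
  have mask_red: "mask_l l u (red2pi x) = mask_l l u x" for x
    unfolding mask_l_def u_def lin_sum_red2pi cos_half_power_red2pi by simp
  have cos1: "\<bar>cos (x/2) ^ k\<bar> \<le> 1" for x :: real and k by (simp add: power_abs power_le_one)
  have cos_g: "\<bar>cos (x/2) ^ (2 * l) * g x\<bar> \<le> \<bar>cos (x/2)\<bar> ^ (2 * l) * \<alpha>" if "\<bar>x\<bar> \<le> pi" for x
    using ga[OF that] by (simp only: abs_mult power_abs) (intro mult_left_mono; simp)
  have cu_eq: "cos (x/2) ^ (2 * l) * u x = cos (x/2) ^ (2 * l) * g x + mM x" if "\<bar>x\<bar> \<le> pi" for x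
    using cos_times_ml[OF that, of l] by (simp add: g_def algebra_simps)
  have gu0: "u 0 = 1 + g 0" by (simp add: g_def ml_0)
  show "near_meyer \<theta> \<omega>0 (mask_l l u) (2 * (real l * \<alpha> + \<gamma>) / c) l"
    unfolding \<mu>_def[symmetric]
  proof (unfold_locales)
    show "0 \<le> 2 * \<mu> / c" using mu c by simp
    show "2 ^ 32 * (2 * \<mu> / c) \<le> 1" using small by (simp add: \<mu>_def)
    show "3 \<le> l" by (rule l)
    show "mask_l l u \<in> borel_measurable borel"
      unfolding mask_l_def[abs_def]
      by (intro borel_measurable_continuous_onI continuous_intros cu) (use u0 in auto)
    fix x
    define y where "y = red2pi x"
    have y: "\<bar>y\<bar> \<le> pi" unfolding y_def by (rule abs_red2pi_le)
    \<comment> \<open>Normalizing by u(0) = 1 + g(0) adds the second error term; together the two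
      account for the factor 2.\<close>
    have "mask_l l u y - mM y = (cos (y/2) ^ (2 * l) * g y - mM y * g 0) / u 0"
      unfolding mask_l_def cu_eq[OF y] using u0 by (simp add: field_simps gu0)
    moreover have "\<bar>cos (y/2) ^ (2 * l) * g y - mM y * g 0\<bar> \<le> 2 * \<mu>"
    proof -
      have "\<bar>cos (y/2) ^ (2 * l) * g y\<bar> \<le> 1 * \<alpha>"
        unfolding abs_mult using ga[OF y] a0 by (intro mult_mono cos1) auto
      moreover have "\<bar>mM y * g 0\<bar> \<le> 1 * \<alpha>"
        unfolding abs_mult using mM_range[of y] ga[of 0] a0 by (intro mult_mono) auto
      ultimately show ?thesis using mu by linarith
    qed
    ultimately have "\<bar>mask_l l u y - mM y\<bar> \<le> 2 * \<mu> / c" using div_c by simp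
    then show "\<bar>mask_l l u x - mM x\<bar> \<le> 2 * \<mu> / c" unfolding y_def mask_red mM_red .
    show "\<bar>mask_l l u x\<bar> \<le> 2 * \<mu> / c * \<bar>cos (x/2)\<bar> ^ (2 * l)" if bad: "pi - \<omega>0 \<le> \<bar>red2pi x\<bar>"
    proof -
      have "mM y = 0" using bad mM_zero unfolding y_def mM_red by simp
      then have "mask_l l u y = (cos (y/2) ^ (2 * l) * g y) / u 0"
        unfolding mask_l_def cu_eq[OF y] by simp
      then have "\<bar>mask_l l u y\<bar> \<le> \<bar>cos (y/2)\<bar> ^ (2 * l) * \<alpha> / c" using div_c[OF cos_g[OF y]] by simp
      also have "\<dots> \<le> \<bar>cos (y/2)\<bar> ^ (2 * l) * (2 * \<mu>) / c"
        using mu c by (intro divide_right_mono mult_left_mono) auto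
      also have "\<bar>cos (y/2)\<bar> ^ (2 * l) = \<bar>cos (x/2)\<bar> ^ (2 * l)"
        unfolding y_def using cos_half_power_red2pi[of x l] by (simp only: power_abs[symmetric])
      finally show ?thesis unfolding y_def mask_red by (simp add: mult.commute)
    qed
    show "\<bar>mask_l l u x - 1\<bar> \<le> 2 * \<mu> / c * \<bar>x\<bar>" if low: "\<bar>x\<bar> \<le> \<omega>0"
    proof -
      define h where "h t = cos (t/2) ^ (2 * l) * g t" for t
      have small_pi: "\<bar>t\<bar> \<le> pi" if "t \<in> {-\<omega>0..\<omega>0}" for t using that om0 by auto
      have "norm (h x - h 0) \<le> \<mu> * norm (x - 0)"
      \<comment> \<open>Differentiating the cosine power yields 2l * 1/2 = l times a bounded factor,
        so the derivative is at most l \<open>\<alpha>\<close> + \<open>\<gamma>\<close>.\<close>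
      proof (rule field_differentiable_bound[of "{-\<omega>0..\<omega>0}"])
        fix t assume t: "t \<in> {-\<omega>0..\<omega>0}"
        have "((\<lambda>x. cos (x/2) ^ (2 * l)) has_real_derivative (real (2 * l) * (- sin (t/2) * (1/2) * cos (t/2) ^ (2 * l - 1)))) (at t)"
          by (rule derivative_eq_intros refl | simp)+
        from DERIV_mult[OF this g'[OF small_pi[OF t]]]
        have "(h has_real_derivative real (2 * l) * (- sin (t/2) * (1/2) * cos (t/2) ^ (2 * l - 1)) * g t
            + (u1 t - d t) * cos (t/2) ^ (2 * l)) (at t)" unfolding h_def[abs_def] by simp
        then show "(h has_real_derivative real (2 * l) * (- sin (t/2) * (1/2) * cos (t/2) ^ (2 * l - 1)) * g t
            + (u1 t - d t) * cos (t/2) ^ (2 * l)) (at t within {-\<omega>0..\<omega>0})"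
          by (rule has_field_derivative_at_within)
        have "\<bar>sin (t/2) * cos (t/2) ^ (2 * l - 1)\<bar> \<le> 1 * 1"
          unfolding abs_mult by (intro mult_mono cos1) auto
        then have "\<bar>sin (t/2) * cos (t/2) ^ (2 * l - 1)\<bar> * \<bar>g t\<bar> \<le> 1 * \<alpha>"
          using ga[OF small_pi[OF t]] by (intro mult_mono) auto
        then have "real l * (\<bar>sin (t/2) * cos (t/2) ^ (2 * l - 1)\<bar> * \<bar>g t\<bar>) \<le> real l * \<alpha>"
          by (intro mult_left_mono) auto
        moreover have "\<bar>real (2 * l) * (- sin (t/2) * (1/2) * cos (t/2) ^ (2 * l - 1)) * g t\<bar>
            = real l * (\<bar>sin (t/2) * cos (t/2) ^ (2 * l - 1)\<bar> * \<bar>g t\<bar>)"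
          by (simp add: abs_mult)
        moreover have "\<bar>(u1 t - d t) * cos (t/2) ^ (2 * l)\<bar> \<le> \<gamma> * 1"
          unfolding abs_mult[of "u1 t - d t"] using gg[OF small_pi[OF t]] g0 by (intro mult_mono cos1) auto
        ultimately show "norm (real (2 * l) * (- sin (t/2) * (1/2) * cos (t/2) ^ (2 * l - 1)) * g t
            + (u1 t - d t) * cos (t/2) ^ (2 * l)) \<le> \<mu>"
          unfolding \<mu>_def real_norm_def by linarith
      qed (use low om0_pos in auto)
      then have "\<bar>h x - h 0\<bar> \<le> \<mu> * \<bar>x\<bar>" by simp
      moreover have "mask_l l u x - 1 = (h x - h 0) / u 0"
      proof -
        have x: "\<bar>x\<bar> \<le> pi" using low om0 by linarith
        have "mM x = 1" using low by (simp add: mM_eq[OF x] phi_one abs_mult)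
        then show ?thesis unfolding mask_l_def cu_eq[OF x] h_def using u0 by (simp add: field_simps gu0)
      qed
      ultimately have "\<bar>mask_l l u x - 1\<bar> \<le> \<mu> * \<bar>x\<bar> / c" using div_c by simp
      also have "\<dots> \<le> 2 * \<mu> * \<bar>x\<bar> / c" using mu c by (intro divide_right_mono mult_right_mono) auto
      finally show ?thesis by simp
    qed
  qed
qed

end

subsection \<open>Stability of the frequency radius\<close>

context meyer begin

lemma phi_meas: "\<phi> \<in> borel_measurable borel"
  using phi_C1 by (metis DERIV_isCont borel_measurable_continuous_onI continuous_at_imp_continuous_on)

lemma moment_phi_pos: "moment 0 \<phi> > 0"
proof -
  have "(\<integral>x. indicator {-1..1::real} x \<partial>lborel) \<le> moment 0 \<phi>"
    unfolding moment_def
  proof (rule integral_mono)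
    show "integrable lborel (indicator {-1..1::real} :: real \<Rightarrow> real)" by simp
    show "integrable lborel (\<lambda>x. x ^ 0 * (\<phi> x)\<^sup>2)" by (rule moment_integrable[OF phi_meas phi_sq_le]) simp
    show "indicator {-1..1::real} x \<le> x ^ 0 * (\<phi> x)\<^sup>2" for x
    proof (cases "x \<in> {-1..1}")
      case True
      then have "\<bar>x\<bar> \<le> 2 * \<omega>0" using om0 pi_gt3 by auto
      then show ?thesis by (simp add: phi_one indicator_def)
    qed simp
  qed
  then show ?thesis by simp
qed

end

section \<open>The asymptotic estimate for the squared frequency radius\<close>

theorem theorem3:
  fixes \<theta> :: "real \<Rightarrow> real" and \<omega>0 :: real
    and lam :: "nat \<Rightarrow> nat \<Rightarrow> real" and nl :: "nat \<Rightarrow> nat" and l0 :: nat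
    and u u1 :: "nat \<Rightarrow> real \<Rightarrow> real" and \<alpha> \<gamma> \<epsilon> \<mu> :: "nat \<Rightarrow> real" and c :: real
  assumes theta: "admissible_theta \<theta>"
    and om0: "pi/3 \<le> \<omega>0" "\<omega>0 < pi/2"
    and u_def: "\<And>l. u l = lin_sum lam (nl l) (meyer_mask_l \<theta> \<omega>0 l)"
    and u1_def: "\<And>l. u1 l = lin_sum lam (nl l) (deriv (meyer_mask_l \<theta> \<omega>0 l))"
    and alpha_def: "\<And>l. \<alpha> l = supC (\<lambda>\<omega>. u l \<omega> - meyer_mask_l \<theta> \<omega>0 l \<omega>)"
    and gamma_def: "\<And>l. \<gamma> l = supC (\<lambda>\<omega>. u1 l \<omega> - deriv (meyer_mask_l \<theta> \<omega>0 l) \<omega>)"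
    and alpha_o: "\<alpha> \<in> o(\<lambda>l. 1 / real l)"
    and gamma_o: "\<gamma> \<in> o(\<lambda>l. 1)"
    and u_pi: "\<And>l. u l pi \<noteq> 0"
    and c_def: "c = (INF l\<in>{l0..}. \<bar>u l 0\<bar>)"
    and c_pos: "c > 0"
    and eps_def: "\<And>l. \<epsilon> l = \<alpha> l / supC (meyer_mask_l \<theta> \<omega>0 l)"
    and mu_def: "\<And>l. \<mu> l = real l * \<alpha> l + \<gamma> l"
  shows "(\<lambda>l. \<bar>freq_radius_sq (orth_hat l (u l)) - freq_radius_sq (meyer_hat \<theta> \<omega>0)\<bar>)
           \<in> O(\<lambda>l. max (\<mu> l)
                 ((4 * exp (2*\<omega>0)) powr (- 2 * real l + 4 * log 2 ((1 + \<epsilon> l) / c))))"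
proof -
  interpret meyer \<theta> \<omega>0 by unfold_locales (use theta om0 in auto)
  define I0 :: real where "I0 = (\<integral>x. 1 / (1 + x\<^sup>2) \<partial>lborel)"
  define C where "C = 6 * 2 ^ 32 * (1 + 676 * Wsum)"
  define f where "f l = orth_hat l (u l)" for l
  have mu_o: "\<mu> \<in> o(\<lambda>_. 1)"
  proof -
    have "(\<lambda>l. real l * \<alpha> l) \<in> o(\<lambda>l. real l * (1 / real l))"
      by (rule landau_o.big_small_mult[OF _ alpha_o]) simp
    \<comment> \<open>At l = 0 the product is 0 by the division convention, so the bound 1 holds for
      all l.\<close>
    moreover have "(\<lambda>l. real l * (1 / real l)) \<in> O(\<lambda>_. 1)"
      by (intro bigoI[where c=1] always_eventually allI) auto
    ultimately have "(\<lambda>l. real l * \<alpha> l) \<in> o(\<lambda>_. 1)" by (rule landau_o.small_big_trans)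
    then have "(\<lambda>l. real l * \<alpha> l + \<gamma> l) \<in> o(\<lambda>_. 1)" using gamma_o by (rule sum_in_smallo)
    then show ?thesis unfolding mu_def[abs_def, symmetric] by (simp add: mu_def)
  qed
  then have mu_lim: "\<mu> \<longlonglongrightarrow> 0" using smalloD_tendsto[OF mu_o] by simp
  have c_le: "c \<le> \<bar>u l 0\<bar>" if "l \<ge> l0" for l
    unfolding c_def by (rule cINF_lower) (use that in \<open>auto intro!: bdd_belowI2[where m=0]\<close>)
  have eta_lim: "(\<lambda>l. K * (2 * \<mu> l / c)) \<longlonglongrightarrow> 0" for K
    using tendsto_mult[OF tendsto_const tendsto_divide[OF tendsto_mult[OF tendsto_const mu_lim, of 2] tendsto_const, of c], of K] c_pos by simp
  \<comment> \<open>The first three conditions make \<open>approximate_mask_near\<close> applicable;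
    the last is the smallness demanded by \<open>orth_sq_near\<close>.\<close>
  have ev: "eventually (\<lambda>l. l \<ge> 3 \<and> l \<ge> l0 \<and> 2^32 * (2 * \<mu> l / c) < 1 \<and> (3 * 2 ^ 32 * Wsum) * (2 * \<mu> l / c) < 1/2) sequentially"
    by (intro eventually_conj eventually_ge_at_top order_tendstoD(2)[OF eta_lim]) auto
  have good: "0 \<le> \<mu> l \<and> f l \<in> borel_measurable borel \<and>
      (\<forall>x. \<bar>(f l x)\<^sup>2 - (\<phi> x)\<^sup>2\<bar> \<le> C * (2 * \<mu> l / c) * (1 / (1 + x\<^sup>2)\<^sup>2))"
    if large: "l \<ge> 3" "l \<ge> l0" "2^32 * (2 * \<mu> l / c) < 1" "(3 * 2 ^ 32 * Wsum) * (2 * \<mu> l / c) < 1/2" for l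
  proof -

    note am = approximate_mask_near[where lam=lam and n="nl l" and l=l and c=c, folded u_def, folded u1_def,
        folded alpha_def gamma_def, folded mu_def, OF large(1) c_pos c_le[OF large(2)] less_imp_le[OF large(3)]]
    interpret near_meyer \<theta> \<omega>0 "mask_l l (u l)" "2 * \<mu> l / c" l by (rule am(1))
    have f: "f l = (\<lambda>x. P x / sqrt (Phi x))"
      by (simp add: f_def fun_eq_iff orth_hat_def scal_hat_def Phi_l_def P_def Phi_def)
    have "f l \<in> borel_measurable borel" unfolding f using P_meas Phi_meas by measurable
    moreover have "\<bar>(f l x)\<^sup>2 - (\<phi> x)\<^sup>2\<bar> \<le> C * (2 * \<mu> l / c) * (1 / (1 + x\<^sup>2)\<^sup>2)" for x
      unfolding f C_def by (rule orth_sq_near) (use large(4) in \<open>simp add: mult_ac\<close>)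
    moreover have "0 \<le> \<mu> l" using am(2,3) by (simp add: mu_def)
    ultimately show ?thesis by blast
  qed

  \<comment> \<open>This majorant may depend on l, as it only serves integrability of the
    moments.\<close>
  have f_le: "(f l x)\<^sup>2 \<le> (676 + C * (2 * \<mu> l / c)) * (1 / (1 + x\<^sup>2)\<^sup>2)"
    if "\<bar>(f l x)\<^sup>2 - (\<phi> x)\<^sup>2\<bar> \<le> C * (2 * \<mu> l / c) * (1 / (1 + x\<^sup>2)\<^sup>2)" for l x
    using that phi_sq_le[of x] unfolding distrib_right by linarith
  have mom: "(\<lambda>l. moment p (f l) - moment p \<phi>) \<in> O(\<mu>)" if p: "p \<le> 2" for p
  proof (rule bigoI[where c="C * (2 / c) * I0"])
    show "eventually (\<lambda>l. norm (moment p (f l) - moment p \<phi>) \<le> C * (2 / c) * I0 * norm (\<mu> l)) sequentially"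
      using ev
    proof eventually_elim
      case (elim l)
      then have g: "0 \<le> \<mu> l" "f l \<in> borel_measurable borel"
        "\<And>x. \<bar>(f l x)\<^sup>2 - (\<phi> x)\<^sup>2\<bar> \<le> C * (2 * \<mu> l / c) * (1 / (1 + x\<^sup>2)\<^sup>2)"
        using good[of l] by auto
      have "\<bar>moment p (f l) - moment p \<phi>\<bar> \<le> C * (2 * \<mu> l / c) * I0"
        unfolding I0_def by (rule moment_diff_le[OF g(2) f_le[OF g(3)] phi_meas phi_sq_le g(3) p])
      then show ?case using g(1) by (simp add: mult_ac)
    qed
  qed
  have nz: "moment 0 \<phi> \<noteq> 0" using moment_phi_pos by simp
  have q2: "(\<lambda>l. moment 2 (f l) / moment 0 (f l) - moment 2 \<phi> / moment 0 \<phi>) \<in> O(\<mu>)"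
    by (rule bigo_quotient_diff[OF mom mom mu_o nz]) auto
  have q1: "(\<lambda>l. moment 1 (f l) / moment 0 (f l) - moment 1 \<phi> / moment 0 \<phi>) \<in> O(\<mu>)"
    by (rule bigo_quotient_diff[OF mom mom mu_o nz]) auto
  have q1sq: "(\<lambda>l. (moment 1 (f l) / moment 0 (f l))\<^sup>2 - (moment 1 \<phi> / moment 0 \<phi>)\<^sup>2) \<in> O(\<mu>)"
  proof -
    define a b where "a l = moment 1 (f l) / moment 0 (f l)" and "b = moment 1 \<phi> / moment 0 \<phi>" for l
    have ab: "(\<lambda>l. a l - b) \<in> O(\<mu>)" using q1 by (simp add: a_def b_def)
    then have "(\<lambda>l. a l - b) \<in> O(\<lambda>_. 1)"
      using landau_o.big_small_trans[OF _ mu_o] landau_o.small_imp_big by blast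
    then have "(\<lambda>l. (a l - b) + 2 * b) \<in> O(\<lambda>_. 1)" by (rule sum_in_bigo(1)) simp
    \<comment> \<open>Here a^2 - b^2 = (a - b)((a - b) + 2b), and the second factor is
      bounded.\<close>
    from landau_o.big.mult[OF ab this] have "(\<lambda>l. (a l)\<^sup>2 - b\<^sup>2) \<in> O(\<mu>)"
      by (simp add: power2_eq_square algebra_simps)
    then show ?thesis by (simp add: a_def b_def)
  qed
  have ev_nz: "eventually (\<lambda>l. moment 0 (f l) \<noteq> 0) sequentially"
  proof -
    have "(\<lambda>l. moment 0 (f l) - moment 0 \<phi>) \<longlonglongrightarrow> 0"
      using smalloD_tendsto[OF landau_o.big_small_trans[OF mom[of 0] mu_o]] by simp
    then have "(\<lambda>l. moment 0 (f l)) \<longlonglongrightarrow> moment 0 \<phi>" by (simp add: LIM_zero_iff)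
    then show ?thesis using nz by (rule tendsto_imp_eventually_ne)
  qed
  have d: "(\<lambda>l. (moment 2 (f l) / moment 0 (f l) - moment 2 \<phi> / moment 0 \<phi>)
       - ((moment 1 (f l) / moment 0 (f l))\<^sup>2 - (moment 1 \<phi> / moment 0 \<phi>)\<^sup>2)) \<in> O(\<mu>)" (is "?d \<in> _")
    by (intro sum_in_bigo q2 q1sq)
  have "eventually (\<lambda>l. ?d l = freq_radius_sq (f l) - freq_radius_sq \<phi>) sequentially"
    using ev ev_nz
  proof eventually_elim
    case (elim l)
    then have g: "f l \<in> borel_measurable borel"
        "\<And>x. \<bar>(f l x)\<^sup>2 - (\<phi> x)\<^sup>2\<bar> \<le> C * (2 * \<mu> l / c) * (1 / (1 + x\<^sup>2)\<^sup>2)"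
        using good[of l] by auto
    show ?case
      using freq_radius_sq_moments[OF g(1) f_le[OF g(2)] elim(2)]
        freq_radius_sq_moments[OF phi_meas phi_sq_le nz] by simp
  qed
  from landau_o.big.in_cong[THEN iffD1, OF this d]
  have "(\<lambda>l. freq_radius_sq (f l) - freq_radius_sq \<phi>) \<in> O(\<mu>)" .
  then have main: "(\<lambda>l. \<bar>freq_radius_sq (f l) - freq_radius_sq \<phi>\<bar>) \<in> O(\<mu>)" by simp
  \<comment> \<open>Since \<open>\<mu>\<close> is eventually nonnegative, its modulus is at most
    that of its maximum with any other quantity.\<close>
  have "\<mu> \<in> O(\<lambda>l. max (\<mu> l) (E l))" for E :: "nat \<Rightarrow> real"
  proof (rule bigoI[where c=1])
    show "eventually (\<lambda>l. norm (\<mu> l) \<le> 1 * norm (max (\<mu> l) (E l))) sequentially"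
      using ev by eventually_elim (use good in \<open>auto simp: max_def\<close>)
  qed
  from landau_o.big_trans[OF main this] show ?thesis unfolding f_def .
qed

end
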